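(* Let $\mathcal{A}$ be any first-order structure with universe $U_{\mathcal{A}}$ and let $Q=U_{\mathcal{A}}^\infty$. Then $(\mathrm{SDEC}_{\mathcal{A}}^\nu)^Q=\mathrm{SDEC}_{\mathcal{A}}^{\mathrm{ND}}$.
   Context: A first-order structure $\mathcal{A}=(U_{\mathcal{A}};(c_i)_{i};(f_i)_{i};(r_i)_{i})$ has a universe, constants, functions $f_i$ of arity $m_i$ and relations $r_i$ of arity $k_i$ (the identity relation need not be among them). $U_{\mathcal{A}}^\infty=\bigcup_{n\ge1}U_{\mathcal{A}}^n$. A (deterministic) BSS RAM $\mathcal{M}$ over $\mathcal{A}$ has $Z$-registers $Z_1,Z_2,\dots$ (holding elements of $U_{\mathcal{A}}$), finitely many index registers $I_1,\dots,I_{k}$ (holding positive integers), and a program: a finite sequence of labeled instructions $1,\dots,\ell_{\mathcal P}$, the last being the only stop instruction, each of one of the types: $Z_j:=f_i(Z_{j_1},\dots,Z_{j_{m_i}})$; $Z_j:=c_i$; $Z_{I_j}:=Z_{I_k}$; if $r_i(Z_{j_1},\dots,Z_{j_{k_i}})$ then goto $\ell_1$ else goto $\ell_2$; if $I_j=I_k$ then goto $\ell_1$ else goto $\ell_2$; $I_j:=1$; $I_j:=I_j+1$; stop. A configuration is $(\ell,\nu_1,\dots,\nu_k,u_1,u_2,\dots)$, transformed step by step in the obvious way. On input $\vec x=(x_1,\dots,x_n)$ the initial configuration is $(1,(n,1,\dots,1),(x_1,\dots,x_n,x_n,x_n,\dots))$; at the stop label the output is $(u_1,\dots,u_{\nu_1})$.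 The halting set of a machine is the set of inputs with at least one halting computation. A non-deterministic BSS RAM over $\mathcal{A}$ is like a deterministic one except that on input $\vec x$ every configuration $(1,(n,1,\dots,1),(x_1,\dots,x_n,y_1,\dots,y_m,x_n,x_n,\dots))$ with $m\ge1$ and arbitrary guesses $(y_1,\dots,y_m)\in U_{\mathcal{A}}^m$ is an admissible initial configuration. $\mathrm{SDEC}_{\mathcal{A}}^{\mathrm{ND}}$ is the class of halting sets of such machines. For $Q\subseteq U_{\mathcal{A}}^\infty$ and $\vec z\in U_{\mathcal{A}}^\infty$, $\nu[Q](\vec z)=\{y_1\in U_{\mathcal{A}}\mid \exists m\ge1\ \exists y_2,\dots,y_m:\ (\vec z,y_1,\dots,y_m)\in Q\}$. A $\nu$-oracle BSS RAM over $\mathcal{A}$ with oracle $Q$ is a BSS RAM (deterministic input procedure) that may additionally use instructions $Z_j:=\nu[Q](Z_1,\dots,Z_{I_1})$, which set $Z_j$ to an arbitrarily chosen element of $\nu[Q](u_1,\dots,u_{\nu_1})$ (current contents of $Z_1,\dots,Z_{\nu_1}$, $\nu_1$ the content of $I_1$), and loop forever if this set is empty. $(\mathrm{SDEC}_{\mathcal{A}}^\nu)^Q$ is the class of halting sets of $\nu$-oracle BSS RAMs over $\mathcal{A}$ with oracle $Q$. *)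

theory Defs
  imports Main
begin

text \<open>A first-order structure with universe the type 'a (universes are nonempty).
  Constants, function symbols and relation symbols are indexed by index sets
  (possibly empty, possibly infinite) of arbitrary index types 'c, 'f, 'r.
  Functions and relations receive their arguments as a list; their arities are
  given by fn_ar and rl_ar.\<close>

record ('a, 'c, 'f, 'r) struct =
  cI    :: "'c set"
  cst   :: "'c \<Rightarrow> 'a"
  fI    :: "'f set"
  fn    :: "'f \<Rightarrow> 'a list \<Rightarrow> 'a"
  fn_ar :: "'f \<Rightarrow> nat"
  rI    :: "'r set"
  rl    :: "'r \<Rightarrow> 'a list \<Rightarrow> bool"
  rl_ar :: "'r \<Rightarrow> nat"

text \<open>U_A^infinity = union of U_A^n for n >= 1: the nonempty lists.\<close>
definition Uinf :: "'a list set" where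
  "Uinf = {xs. xs \<noteq> []}"

definition nu :: "'a list set \<Rightarrow> 'a list \<Rightarrow> 'a set" where
  "nu Q zs = {y. \<exists>ys. zs @ y # ys \<in> Q}"

datatype ('c, 'f, 'r) instr =
    FunI 'f nat "nat list"          \<comment> \<open>Z_j := f_i(Z_j1, ..., Z_jm)\<close>
  | ConstI nat 'c                   \<comment> \<open>Z_j := c_i\<close>
  | CopyI nat nat                   \<comment> \<open>Z_{I_j} := Z_{I_k}\<close>
  | RelBr 'r "nat list" nat nat     \<comment> \<open>if r_i(Z_j1..) then goto l1 else goto l2\<close>
  | IdxBr nat nat nat nat           \<comment> \<open>if I_j = I_k then goto l1 else goto l2\<close>
  | IdxOne nat
  | IdxInc nat
  | StopI
  | OracleI nat                     \<comment> \<open>Z_j := nu[Q](Z_1, ..., Z_{I_1})\<close>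

record ('c, 'f, 'r) machine =
  nidx :: nat                        \<comment> \<open>number k of index registers I_1..I_k\<close>
  prog :: "('c, 'f, 'r) instr list"  \<comment> \<open>instruction with label l is prog ! (l - 1)\<close>

text \<open>A configuration: label, contents of index registers (I_j = idx j, 1 <= j <= k),
  contents of Z-registers (Z_i = mem i, i >= 1).\<close>
type_synonym 'a config = "nat \<times> (nat \<Rightarrow> nat) \<times> (nat \<Rightarrow> 'a)"

definition wf_instr :: "('a, 'c, 'f, 'r) struct \<Rightarrow> bool \<Rightarrow> nat \<Rightarrow> nat
    \<Rightarrow> ('c, 'f, 'r) instr \<Rightarrow> bool" where
  "wf_instr S orc k L ins = (case ins of
      FunI f j js \<Rightarrow> f \<in> fI S \<and> length js = fn_ar S f \<and> j \<ge> 1 \<and> (\<forall>i\<in>set js. i \<ge> 1)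
    | ConstI j c \<Rightarrow> c \<in> cI S \<and> j \<ge> 1
    | CopyI j j' \<Rightarrow> j \<in> {1..k} \<and> j' \<in> {1..k}
    | RelBr r js l1 l2 \<Rightarrow> r \<in> rI S \<and> length js = rl_ar S r \<and> (\<forall>i\<in>set js. i \<ge> 1)
                          \<and> l1 \<in> {1..L} \<and> l2 \<in> {1..L}
    | IdxBr j j' l1 l2 \<Rightarrow> j \<in> {1..k} \<and> j' \<in> {1..k} \<and> l1 \<in> {1..L} \<and> l2 \<in> {1..L}
    | IdxOne j \<Rightarrow> j \<in> {1..k}
    | IdxInc j \<Rightarrow> j \<in> {1..k}
    | StopI \<Rightarrow> True
    | OracleI j \<Rightarrow> orc \<and> j \<ge> 1)"

definition wf_machine :: "('a, 'c, 'f, 'r) struct \<Rightarrow> bool \<Rightarrow> ('c, 'f, 'r) machine \<Rightarrow> bool" where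
  "wf_machine S orc M = (nidx M \<ge> 1 \<and> prog M \<noteq> [] \<and> last (prog M) = StopI
     \<and> (\<forall>i < length (prog M) - 1. prog M ! i \<noteq> StopI)
     \<and> (\<forall>ins \<in> set (prog M). wf_instr S orc (nidx M) (length (prog M)) ins))"

text \<open>One computation step (nondeterministic only through the oracle instruction;
  if nu[Q](...) is empty there is no successor, i.e. the machine never halts on that path).\<close>
definition step :: "('a, 'c, 'f, 'r) struct \<Rightarrow> 'a list set \<Rightarrow> ('c, 'f, 'r) machine
    \<Rightarrow> 'a config \<Rightarrow> 'a config \<Rightarrow> bool" where
  "step S Q M c c' = (case c of (l, idx, mem) \<Rightarrow>
     1 \<le> l \<and> l \<le> length (prog M) \<and>
     (case prog M ! (l - 1) of
        FunI f j js \<Rightarrow> c' = (l + 1, idx, mem(j := fn S f (map mem js)))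
      | ConstI j ci \<Rightarrow> c' = (l + 1, idx, mem(j := cst S ci))
      | CopyI j j' \<Rightarrow> c' = (l + 1, idx, mem(idx j := mem (idx j')))
      | RelBr r js l1 l2 \<Rightarrow> c' = ((if rl S r (map mem js) then l1 else l2), idx, mem)
      | IdxBr j j' l1 l2 \<Rightarrow> c' = ((if idx j = idx j' then l1 else l2), idx, mem)
      | IdxOne j \<Rightarrow> c' = (l + 1, idx(j := 1), mem)
      | IdxInc j \<Rightarrow> c' = (l + 1, idx(j := idx j + 1), mem)
      | StopI \<Rightarrow> False
      | OracleI j \<Rightarrow> (\<exists>y \<in> nu Q (map mem [1..<idx 1 + 1]). c' = (l + 1, idx, mem(j := y)))))"

definition init_mem :: "'a list \<Rightarrow> 'a list \<Rightarrow> nat \<Rightarrow> 'a" where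
  "init_mem xs ys i = (if 1 \<le> i \<and> i \<le> length (xs @ ys) then (xs @ ys) ! (i - 1) else last xs)"

definition init_config :: "'a list \<Rightarrow> 'a list \<Rightarrow> 'a config" where
  "init_config xs ys = (1, (\<lambda>j. if j = 1 then length xs else 1), init_mem xs ys)"

definition halts_from :: "('a, 'c, 'f, 'r) struct \<Rightarrow> 'a list set \<Rightarrow> ('c, 'f, 'r) machine
    \<Rightarrow> 'a config \<Rightarrow> bool" where
  "halts_from S Q M c = (\<exists>c'. (step S Q M)\<^sup>*\<^sup>* c c' \<and> fst c' = length (prog M))"

definition halt_set :: "('a, 'c, 'f, 'r) struct \<Rightarrow> 'a list set \<Rightarrow> ('c, 'f, 'r) machine
    \<Rightarrow> 'a list set" where
  "halt_set S Q M = {xs. xs \<in> Uinf \<and> halts_from S Q M (init_config xs [])}"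

definition nd_halt_set :: "('a, 'c, 'f, 'r) struct \<Rightarrow> ('c, 'f, 'r) machine \<Rightarrow> 'a list set" where
  "nd_halt_set S M = {xs. xs \<in> Uinf \<and> (\<exists>ys. ys \<noteq> [] \<and> halts_from S {} M (init_config xs ys))}"

definition SDEC_ND :: "('a, 'c, 'f, 'r) struct \<Rightarrow> 'a list set set" where
  "SDEC_ND S = {nd_halt_set S M | M. wf_machine S False M}"

definition SDEC_nu :: "('a, 'c, 'f, 'r) struct \<Rightarrow> 'a list set \<Rightarrow> 'a list set set" where
  "SDEC_nu S Q = {halt_set S Q M | M. wf_machine S True M}"

end

theory Submission
  imports Defs
begin

text \<open>
  For \<open>Q = U\<^sup>\<infinity>\<close> the oracle returns an arbitrary element, so an oracle call is a guess made during
  the computation. Control flow may be unable to depend on guessed elements, hence the number of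
  guesses cannot itself be guessed. In both directions this is avoided by a counter \<open>D\<close> that
  grows with the index registers and bounds all cells accessed so far.

  An oracle machine simulates a guessing machine lazily: whenever \<open>D\<close> grows, the new cell is
  filled with an oracle answer. Conversely, a guessing machine keeps its unread guesses in the
  cells above \<open>D\<close>, with \<open>x\<^sub>n\<close> in the cell \<open>D\<close>. When \<open>D\<close> grows, a guess is discarded by copying \<open>x\<^sub>n\<close>
  upwards, which leaves \<open>x\<^sub>n\<close>, the correct initial contents, in the cell that becomes accessible;
  an oracle call reads the cell \<open>D + 1\<close> before discarding it. Since a halting computation
  uses finitely many cells, finitely many guesses suffice.
\<close>

type_synonym 'a state = "(nat \<Rightarrow> nat) \<times> (nat \<Rightarrow> 'a)"

section \<open>Halting in a given number of steps\<close>

text \<open>The number of steps is explicit because one source instruction may become a block of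
  several instructions, so the inductions below run over the length of a halting run.\<close>

primrec halts_in :: "('a, 'c, 'f, 'r) struct \<Rightarrow> 'a list set \<Rightarrow> ('c, 'f, 'r) machine
    \<Rightarrow> nat \<Rightarrow> 'a config \<Rightarrow> bool" where
  "halts_in S Q M 0 c = (fst c = length (prog M))"
| "halts_in S Q M (Suc t) c = (\<exists>c1. step S Q M c c1 \<and> halts_in S Q M t c1)"

lemma halts_in_iff_relpowp:
  "halts_in S Q M t c \<longleftrightarrow> (\<exists>c'. (step S Q M ^^ t) c c' \<and> fst c' = length (prog M))"
proof (induction t arbitrary: c)
  case (Suc t)
  show ?case
    unfolding halts_in.simps Suc.IH relpowp.simps relpowp_commute[symmetric] by blast
qed simp

lemma halts_from_iff: "halts_from S Q M c \<longleftrightarrow> (\<exists>t. halts_in S Q M t c)"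
  unfolding halts_from_def halts_in_iff_relpowp by (metis rtranclp_power)

lemma nu_Uinf [simp]: "nu Uinf zs = UNIV"
  by (auto simp: nu_def Uinf_def)

section \<open>Straight-line code and branches\<close>

definition straight :: "('c, 'f, 'r) instr \<Rightarrow> bool" where
  "straight ins = (case ins of RelBr _ _ _ _ \<Rightarrow> False | IdxBr _ _ _ _ \<Rightarrow> False
     | StopI \<Rightarrow> False | _ \<Rightarrow> True)"

lemma straight_simps [simp]:
  "straight (FunI f j js)" "straight (ConstI j c)" "straight (CopyI i i')"
  "\<not> straight (RelBr r js l1 l2)" "\<not> straight (IdxBr i i' l1 l2)" "straight (IdxOne i)"
  "straight (IdxInc i)" "\<not> straight StopI" "straight (OracleI j)"
  by (simp_all add: straight_def)

text \<open>Set-valued, since an oracle call has a choice of successors. Labels are left out, so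
  that the effect is the same wherever the instruction is placed.\<close>

fun eff :: "('a, 'c, 'f, 'r) struct \<Rightarrow> 'a list set \<Rightarrow> ('c, 'f, 'r) instr
    \<Rightarrow> 'a state \<Rightarrow> 'a state set" where
  "eff S Q (FunI f j js) (idx, mem) = {(idx, mem(j := fn S f (map mem js)))}"
| "eff S Q (ConstI j c) (idx, mem) = {(idx, mem(j := cst S c))}"
| "eff S Q (CopyI i i') (idx, mem) = {(idx, mem(idx i := mem (idx i')))}"
| "eff S Q (IdxOne i) (idx, mem) = {(idx(i := 1), mem)}"
| "eff S Q (IdxInc i) (idx, mem) = {(idx(i := idx i + 1), mem)}"
| "eff S Q (OracleI j) (idx, mem) =
     (\<lambda>y. (idx, mem(j := y))) ` nu Q (map mem [1..<idx 1 + 1])"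
| "eff S Q _ _ = {}"

primrec effs :: "('a, 'c, 'f, 'r) struct \<Rightarrow> 'a list set \<Rightarrow> ('c, 'f, 'r) instr list
    \<Rightarrow> 'a state \<Rightarrow> 'a state set" where
  "effs S Q [] s = {s}"
| "effs S Q (ins # inss) s = (\<Union>s1 \<in> eff S Q ins s. effs S Q inss s1)"

lemma effs_append: "effs S Q (xs @ ys) s = (\<Union>s1 \<in> effs S Q xs s. effs S Q ys s1)"
  by (induction xs arbitrary: s) auto

lemma step_straight:
  assumes "1 \<le> l" "l \<le> length (prog M)" "straight (prog M ! (l - 1))"
  shows "step S Q M (l, s) c' \<longleftrightarrow> (\<exists>s1 \<in> eff S Q (prog M ! (l - 1)) s. c' = (Suc l, s1))"
  using assms by (cases s; cases "prog M ! (l - 1)") (auto simp: step_def)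

text \<open>By \<open>bs \<noteq> []\<close> the last label lies outside the block, so no run counts
  as halted inside it, and each instruction uses exactly one step.\<close>

lemma halts_in_straight:
  assumes "prog M = as @ xs @ bs" "bs \<noteq> []" "list_all straight xs" "l = Suc (length as)"
  shows "halts_in S Q M t (l, s) \<longleftrightarrow>
    (\<exists>t'. t = length xs + t' \<and>
       (\<exists>s1 \<in> effs S Q xs s. halts_in S Q M t' (l + length xs, s1)))"
  using assms
proof (induction xs arbitrary: as l s t)
  case (Cons x xs)
  have l: "1 \<le> l" "l < length (prog M)" "prog M ! (l - 1) = x" "straight x"
    using Cons.prems by (auto simp: nth_append)
  have "halts_in S Q M t (l, s) \<longleftrightarrow>
      (\<exists>t1. t = Suc t1 \<and> (\<exists>s1 \<in> eff S Q x s. halts_in S Q M t1 (Suc l, s1)))"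
    using l by (cases t) (auto simp: step_straight)
  moreover have "halts_in S Q M t1 (Suc l, s1) \<longleftrightarrow>
    (\<exists>t'. t1 = length xs + t' \<and>
       (\<exists>s2 \<in> effs S Q xs s1. halts_in S Q M t' (Suc l + length xs, s2)))" for t1 s1
    using Cons.prems by (intro Cons.IH[of "as @ [x]"]) auto
  ultimately show ?case by auto
qed simp

lemma halts_from_straight:
  assumes "prog M = as @ xs @ bs" "bs \<noteq> []" "list_all straight xs" "l = Suc (length as)"
  shows "halts_from S Q M (l, s) \<longleftrightarrow>
    (\<exists>s1 \<in> effs S Q xs s. halts_from S Q M (l + length xs, s1))"
  unfolding halts_from_iff halts_in_straight[OF assms] by auto

fun dest :: "('a, 'c, 'f, 'r) struct \<Rightarrow> ('c, 'f, 'r) instr \<Rightarrow> 'a state \<Rightarrow> nat" where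
  "dest S (RelBr r js l1 l2) s = (if rl S r (map (snd s) js) then l1 else l2)"
| "dest S (IdxBr i j l1 l2) s = (if fst s i = fst s j then l1 else l2)"
| "dest S _ s = 0"

lemma halts_in_branch:
  assumes "1 \<le> l" "l < length (prog M)" "\<not> straight (prog M ! (l - 1))" "prog M ! (l - 1) \<noteq> StopI"
  shows "halts_in S Q M t (l, s) \<longleftrightarrow>
    (\<exists>t'. t = Suc t' \<and> halts_in S Q M t' (dest S (prog M ! (l - 1)) s, s))"
  using assms by (cases t; cases s; cases "prog M ! (l - 1)") (auto simp: step_def)

lemma halts_from_branch:
  assumes "1 \<le> l" "l < length (prog M)" "\<not> straight (prog M ! (l - 1))" "prog M ! (l - 1) \<noteq> StopI"
  shows "halts_from S Q M (l, s) \<longleftrightarrow> halts_from S Q M (dest S (prog M ! (l - 1)) s, s)"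
  unfolding halts_from_iff halts_in_branch[OF assms] by auto

lemma halts_in_finite_use:
  assumes "halts_in S Q M t (l, idx, mem)" "Q = {} \<or> Q = Uinf"
  shows "\<exists>N. \<forall>mem'. (\<forall>i \<le> N. mem' i = mem i) \<longrightarrow> halts_in S Q M t (l, idx, mem')"
  using assms(1)
proof (induction t arbitrary: l idx mem)
  case (Suc t)
  then obtain l1 idx1 mem1 where
    st: "step S Q M (l, idx, mem) (l1, idx1, mem1)" and h: "halts_in S Q M t (l1, idx1, mem1)"
    by auto
  from Suc.IH[OF h] obtain N where
    N: "\<And>mem'. (\<forall>i \<le> N. mem' i = mem1 i) \<Longrightarrow> halts_in S Q M t (l1, idx1, mem')" by blast
  \<comment> \<open>\<open>B\<close> is to bound the cells read by the first instruction,
    \<open>N\<close> those on which the rest of the run depends. Agreement up to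
    \<open>B + N\<close> makes the same first step possible and survives it up to
    \<open>N\<close>.\<close>
  have "\<exists>B. \<forall>mem'. (\<forall>i \<le> B + N. mem' i = mem i) \<longrightarrow>
      (\<exists>mem1'. step S Q M (l, idx, mem') (l1, idx1, mem1') \<and> (\<forall>i \<le> N. mem1' i = mem1 i))"
  proof (cases "prog M ! (l - 1)")
    case (FunI f j js)
    obtain B where B: "\<forall>i \<in> set js. i \<le> B"
      using finite_nat_set_iff_bounded_le[of "set js"] by auto
    have "step S Q M (l, idx, mem') (l1, idx1, mem'(j := fn S f (map mem js)))"
      if "\<forall>i \<le> B + N. mem' i = mem i" for mem'
    proof -
      have "map mem' js = map mem js" using that B by (intro map_cong) auto
      then show ?thesis using st FunI by (simp add: step_def del: map_eq_conv)
    qed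
    moreover have "mem1 = mem(j := fn S f (map mem js))" using st FunI by (simp add: step_def)
    ultimately show ?thesis
      by (intro exI[of _ B] allI impI exI[of _ "_(j := fn S f (map mem js))"]) auto
  next
    case (RelBr r js l1' l2')
    obtain B where B: "\<forall>i \<in> set js. i \<le> B"
      using finite_nat_set_iff_bounded_le[of "set js"] by auto
    have "step S Q M (l, idx, mem') (l1, idx1, mem')"
      if "\<forall>i \<le> B + N. mem' i = mem i" for mem'
    proof -
      have "map mem' js = map mem js" using that B by (intro map_cong) auto
      then show ?thesis using st RelBr by (simp add: step_def del: map_eq_conv)
    qed
    moreover have "mem1 = mem" using st RelBr by (simp add: step_def)
    ultimately show ?thesis by (metis trans_le_add2)
  next
    case (CopyI i i')
    then show ?thesis
      using st by (intro exI[of _ "idx i'"]) (auto simp: step_def)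
  next
    case (OracleI j)
    with st obtain y where "Q = Uinf" "mem1 = mem(j := y)" "l1 = Suc l" "idx1 = idx"
      "1 \<le> l" "l \<le> length (prog M)"
      using assms(2) by (auto simp: step_def nu_def)
    then have "step S Q M (l, idx, mem') (l1, idx1, mem'(j := y))" for mem'
      using OracleI by (auto simp: step_def)
    then show ?thesis
      using \<open>mem1 = _\<close> by (intro exI[of _ 0] allI impI exI[of _ "_(j := y)"]) auto
  qed (use st in \<open>auto simp: step_def\<close>)
  then obtain B where B: "\<And>mem'. (\<forall>i \<le> B + N. mem' i = mem i) \<Longrightarrow>
      (\<exists>mem1'. step S Q M (l, idx, mem') (l1, idx1, mem1') \<and> (\<forall>i \<le> N. mem1' i = mem1 i))"
    by blast
  show ?case
  proof (intro exI allI impI)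
    fix mem' assume "\<forall>i \<le> B + N. mem' i = mem i"
    from B[OF this] N show "halts_in S Q M (Suc t) (l, idx, mem')" by fastforce
  qed
qed simp

lemma halts_from_finite_use:
  assumes "halts_from S Q M (l, idx, mem)" "Q = {} \<or> Q = Uinf"
  shows "\<exists>N. \<forall>mem'. (\<forall>i \<le> N. mem' i = mem i) \<longrightarrow> halts_from S Q M (l, idx, mem')"
  using assms unfolding halts_from_iff by (metis halts_in_finite_use)

section \<open>Blockwise translation of programs\<close>

text \<open>\<open>Q\<close> is the oracle of the simulated machine \<open>src\<close>,
  \<open>Q'\<close> that of the simulating machine \<open>tgt\<close>. The block \<open>ext\<close>
  is meant to raise \<open>D\<close> by one and is run before each increment of an index register;
  \<open>orc j\<close> replaces an oracle call; \<open>m\<close> copies of \<open>ext\<close> in the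
  prologue give \<open>D\<close> a head start.\<close>

locale translation =
  fixes S :: "('a, 'c, 'f, 'r) struct" and Q Q' :: "'a list set" and k m :: nat
    and body ext :: "('c, 'f, 'r) instr list" and orc :: "nat \<Rightarrow> ('c, 'f, 'r) instr list"
  assumes straight_ext: "list_all straight ext"
    and straight_orc: "list_all straight (orc j)"
    and orc_nonempty: "orc j \<noteq> []"
    and no_stop: "StopI \<notin> set body"
begin

definition src :: "('c, 'f, 'r) machine" where
  "src = \<lparr>nidx = k, prog = body @ [StopI]\<rparr>"

definition tlen :: "('c, 'f, 'r) instr \<Rightarrow> nat" where
  "tlen ins = (case ins of IdxInc j \<Rightarrow> Suc (length ext) | OracleI j \<Rightarrow> length (orc j) | _ \<Rightarrow> 1)"

definition off :: nat where "off = 5 + m * length ext"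

text \<open>The target label at which the block of the source label \<open>l\<close> begins;
  \<open>off\<close> is the length of the prologue. For \<open>l = Suc (length body)\<close> it is
  the stop label.\<close>

definition lab :: "nat \<Rightarrow> nat" where
  "lab l = Suc (off + sum_list (map tlen (take (l - 1) body)))"

definition tr :: "('c, 'f, 'r) instr \<Rightarrow> ('c, 'f, 'r) instr list" where
  "tr ins = (case ins of IdxInc j \<Rightarrow> ext @ [IdxInc j] | OracleI j \<Rightarrow> orc j
     | RelBr r js l1 l2 \<Rightarrow> [RelBr r js (lab l1) (lab l2)]
     | IdxBr i j l1 l2 \<Rightarrow> [IdxBr i j (lab l1) (lab l2)]
     | _ \<Rightarrow> [ins])"

text \<open>The first four instructions, a loop, count \<open>I\<^bsub>k+1\<^esub>\<close> and \<open>I\<^bsub>k+2\<^esub>\<close> up to the input length \<open>I\<^sub>1\<close>.\<close>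

definition tgt_prog :: "('c, 'f, 'r) instr list" where
  "tgt_prog = [IdxBr (k + 1) 1 5 2, IdxInc (k + 1), IdxInc (k + 2), IdxBr 1 1 1 1, IdxInc (k + 2)]
     @ concat (replicate m ext) @ concat (map tr body) @ [StopI]"

definition tgt :: "('c, 'f, 'r) machine" where
  "tgt = \<lparr>nidx = k + 3, prog = tgt_prog\<rparr>"

lemma length_tr: "length (tr ins) = tlen ins"
  by (auto simp: tr_def tlen_def split: instr.splits)

lemma tlen_positive: "0 < tlen ins"
  using orc_nonempty by (auto simp: tlen_def split: instr.splits)

lemma straight_tr: "straight ins \<Longrightarrow> list_all straight (tr ins)"
  using straight_ext straight_orc by (auto simp: tr_def split: instr.splits)

lemma length_concat_tr: "length (concat (map tr xs)) = sum_list (map tlen xs)"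
  by (induction xs) (auto simp: length_tr)

lemma length_exts: "length (concat (replicate m ext)) = m * length ext"
  by (simp add: length_concat sum_list_replicate)

lemma length_tgt_prog: "length tgt_prog = lab (Suc (length body))"
  by (simp add: tgt_prog_def lab_def off_def length_concat_tr length_exts)

lemma tgt_prog_split:
  assumes "1 \<le> l" "l \<le> length body"
  obtains as bs where "tgt_prog = as @ tr (body ! (l - 1)) @ bs" "bs \<noteq> []" "lab l = Suc (length as)"
proof -
  have b: "body = take (l - 1) body @ body ! (l - 1) # drop l body"
    using assms id_take_nth_drop[of "l - 1" body] by simp
  have c: "concat (map tr body) = concat (map tr (take (l - 1) body)) @ tr (body ! (l - 1))
      @ concat (map tr (drop l body))"
    by (subst b) simp
  show ?thesis
  proof (rule that)
    show "tgt_prog = (take 5 tgt_prog @ concat (replicate m ext)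
        @ concat (map tr (take (l - 1) body))) @ tr (body ! (l - 1))
        @ (concat (map tr (drop l body)) @ [StopI])"
      unfolding tgt_prog_def c by simp
    show "lab l = Suc (length (take 5 tgt_prog @ concat (replicate m ext)
        @ concat (map tr (take (l - 1) body))))"
      by (simp add: lab_def off_def length_concat_tr length_exts tgt_prog_def)
  qed simp
qed

lemma lab_Suc:
  assumes "1 \<le> l" "l \<le> length body"
  shows "lab (Suc l) = lab l + tlen (body ! (l - 1))"
  using assms take_Suc_conv_app_nth[of "l - 1" body] by (simp add: lab_def)

lemma lab_le_length: "1 \<le> lab l" "lab l \<le> length tgt_prog"
proof -
  have "sum_list (map tlen body) = sum_list (map tlen (take (l - 1) body))
      + sum_list (map tlen (drop (l - 1) body))"
    by (metis append_take_drop_id map_append sum_list_append)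
  then show "lab l \<le> length tgt_prog"
    by (simp add: length_tgt_prog lab_def)
qed (simp add: lab_def)

lemma lab_less_length:
  assumes "1 \<le> l" "l \<le> length body"
  shows "lab l < length tgt_prog"
  using lab_Suc[OF assms] lab_le_length[of "Suc l"] tlen_positive[of "body ! (l - 1)"] by linarith

definition effS :: "'a list set \<Rightarrow> ('c, 'f, 'r) instr list \<Rightarrow> 'a state set \<Rightarrow> 'a state set" where
  "effS R xs X = (\<Union>s \<in> X. effs S R xs s)"

lemma tgt_halts_in_straight:
  assumes "1 \<le> l" "l \<le> length body" "straight (body ! (l - 1))"
  shows "halts_in S Q' tgt t (lab l, s) \<longleftrightarrow>
    (\<exists>t'. t = tlen (body ! (l - 1)) + t' \<and>
       (\<exists>s1 \<in> effs S Q' (tr (body ! (l - 1))) s. halts_in S Q' tgt t' (lab (Suc l), s1)))"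
proof -
  obtain as bs where "tgt_prog = as @ tr (body ! (l - 1)) @ bs" "bs \<noteq> []" "lab l = Suc (length as)"
    using tgt_prog_split assms by blast
  then show ?thesis
    using halts_in_straight[of tgt as "tr (body ! (l - 1))" bs "lab l" S Q' t s]
      straight_tr[OF assms(3)] lab_Suc[OF assms(1,2)] by (simp add: tgt_def length_tr)
qed

lemma src_halts_in_straight:
  assumes "1 \<le> l" "l \<le> length body" "straight (body ! (l - 1))"
  shows "halts_in S Q src t (l, s) \<longleftrightarrow>
    (\<exists>t'. t = Suc t' \<and> (\<exists>s1 \<in> eff S Q (body ! (l - 1)) s. halts_in S Q src t' (Suc l, s1)))"
  using assms by (cases t) (auto simp: step_straight src_def nth_append)

lemma tgt_halts_in_branch:
  assumes "1 \<le> l" "l \<le> length body" "\<not> straight (body ! (l - 1))"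
  shows "halts_in S Q' tgt t (lab l, s) \<longleftrightarrow>
    (\<exists>t'. t = Suc t' \<and> halts_in S Q' tgt t' (lab (dest S (body ! (l - 1)) s), s))"
proof -
  have "body ! (l - 1) \<in> set body" using assms by simp
  then have "body ! (l - 1) \<noteq> StopI" using no_stop by metis
  then obtain ins where ins: "tr (body ! (l - 1)) = [ins]" "\<not> straight ins" "ins \<noteq> StopI"
      "dest S ins s = lab (dest S (body ! (l - 1)) s)"
    using assms(3) by (cases "body ! (l - 1)") (auto simp: tr_def)
  obtain as bs where "tgt_prog = as @ tr (body ! (l - 1)) @ bs" "lab l = Suc (length as)"
    using tgt_prog_split assms by blast
  then have "prog tgt ! (lab l - 1) = ins" using ins by (simp add: tgt_def)
  then show ?thesis
    using halts_in_branch[of "lab l" tgt S Q' t s] ins lab_le_length[of l]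
      lab_less_length[OF assms(1,2)] by (simp add: tgt_def)
qed

lemma src_halts_in_branch:
  assumes "1 \<le> l" "l \<le> length body" "\<not> straight (body ! (l - 1))"
  shows "halts_in S Q src t (l, s) \<longleftrightarrow>
    (\<exists>t'. t = Suc t' \<and> halts_in S Q src t' (dest S (body ! (l - 1)) s, s))"
proof -
  have "body ! (l - 1) \<in> set body" using assms by simp
  then have "body ! (l - 1) \<noteq> StopI" using no_stop by metis
  moreover have "prog src ! (l - 1) = body ! (l - 1)" "l < length (prog src)"
    using assms by (auto simp: src_def nth_append)
  ultimately show ?thesis
    using halts_in_branch[of l src S Q t s] assms by simp
qed

text \<open>A state of one machine is related to a \<^emph>\<open>set\<close> of states of the other, so that memory
  cells whose contents are to be guessed can be left open until a later step fixes them.\<close>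

lemma forward_simulation:
  assumes ok: "\<And>ins s. ins \<in> set body \<Longrightarrow> \<not> straight ins \<Longrightarrow> dest S ins s \<in> {1..Suc (length body)}"
    and ne: "\<And>s X. K s X \<Longrightarrow> X \<noteq> {}"
    and br: "\<And>ins s X s'. ins \<in> set body \<Longrightarrow> K s X \<Longrightarrow> s' \<in> X \<Longrightarrow> dest S ins s' = dest S ins s"
    and st: "\<And>ins s X s1. ins \<in> set body \<Longrightarrow> straight ins \<Longrightarrow> K s X \<Longrightarrow> s1 \<in> eff S Q ins s
      \<Longrightarrow> \<exists>X1. K s1 X1 \<and> X1 \<subseteq> effS Q' (tr ins) X"
    and h: "halts_in S Q src t (l, s)" and K: "K s X" and l: "1 \<le> l" "l \<le> Suc (length body)"
  shows "\<exists>s' \<in> X. halts_from S Q' tgt (lab l, s')"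
  using h K l
proof (induction t arbitrary: l s X rule: less_induct)
  case (less t)
  show ?case
  proof (cases "l = Suc (length body)")
    case True
    \<comment> \<open>At the stop label every state halts, so nonemptiness of \<open>X\<close>
      suffices.\<close>
    obtain s' where "s' \<in> X" using ne less.prems by blast
    moreover have "halts_in S Q' tgt 0 (lab l, s')"
      using True by (simp add: tgt_def length_tgt_prog)
    ultimately show ?thesis unfolding halts_from_iff by blast
  next
    case False
    define ins where "ins = body ! (l - 1)"
    have l: "1 \<le> l" "l \<le> length body" using False less.prems by auto
    then have ins: "ins \<in> set body" by (simp add: ins_def)
    show ?thesis
    proof (cases "straight ins")
      case True
      then obtain t' s1 where t': "t = Suc t'" and s1: "s1 \<in> eff S Q ins s"
        and h1: "halts_in S Q src t' (Suc l, s1)"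
        using less.prems(1) l src_halts_in_straight by (auto simp: ins_def)
      \<comment> \<open>The induction hypothesis selects a halting state in \<open>X1\<close>, and
        only then is a predecessor of it selected in \<open>X\<close>: choices are made backwards
        along the run.\<close>
      from st[OF ins True less.prems(2) s1] obtain X1 where
        X1: "K s1 X1" "X1 \<subseteq> effS Q' (tr ins) X" by blast
      obtain s1' where s1': "s1' \<in> X1" "halts_from S Q' tgt (lab (Suc l), s1')"
        using less.IH[OF _ h1 X1(1)] t' l by auto
      then obtain s' where "s' \<in> X" "s1' \<in> effs S Q' (tr ins) s'"
        using X1 by (auto simp: effS_def)
      moreover obtain t1 where "halts_in S Q' tgt t1 (lab (Suc l), s1')"
        using s1'(2) by (auto simp: halts_from_iff)
      ultimately have "halts_in S Q' tgt (tlen ins + t1) (lab l, s')"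
        using tgt_halts_in_straight[OF l, of "tlen ins + t1" s'] True by (auto simp: ins_def)
      with \<open>s' \<in> X\<close> show ?thesis unfolding halts_from_iff by blast
    next
      case False
      define l' where "l' = dest S ins s"
      obtain t' where t': "t = Suc t'" "halts_in S Q src t' (l', s)"
        using less.prems(1) src_halts_in_branch[OF l] False by (auto simp: l'_def ins_def)
      obtain s' where s': "s' \<in> X" "halts_from S Q' tgt (lab l', s')"
        using less.IH[OF _ t'(2) less.prems(2)] t' ok[OF ins False, of s] by (auto simp: l'_def)
      have "dest S ins s' = l'"
        using br[OF ins less.prems(2) s'(1)] by (simp add: l'_def)
      moreover obtain t1 where "halts_in S Q' tgt t1 (lab l', s')"
        using s'(2) by (auto simp: halts_from_iff)
      ultimately have "halts_in S Q' tgt (Suc t1) (lab l, s')"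
        using tgt_halts_in_branch[OF l, of "Suc t1" s'] False by (simp add: ins_def)
      with s'(1) show ?thesis unfolding halts_from_iff by blast
    qed
  qed
qed

text \<open>Now the run of the target is given and each source step consumes a whole block of it.
  The descent in the strong induction comes from \<open>tlen_positive\<close>.\<close>

lemma backward_simulation:
  assumes ok: "\<And>ins s. ins \<in> set body \<Longrightarrow> \<not> straight ins \<Longrightarrow> dest S ins s \<in> {1..Suc (length body)}"
    and ne: "\<And>s' X. K s' X \<Longrightarrow> X \<noteq> {}"
    and br: "\<And>ins s' X s. ins \<in> set body \<Longrightarrow> K s' X \<Longrightarrow> s \<in> X \<Longrightarrow> dest S ins s = dest S ins s'"
    and st: "\<And>ins s' X s1'. ins \<in> set body \<Longrightarrow> straight ins \<Longrightarrow> K s' X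
      \<Longrightarrow> s1' \<in> effs S Q' (tr ins) s' \<Longrightarrow> \<exists>X1. K s1' X1 \<and> X1 \<subseteq> effS Q [ins] X"
    and h: "halts_in S Q' tgt t (lab l, s')" and K: "K s' X"
    and l: "1 \<le> l" "l \<le> Suc (length body)"
  shows "\<exists>s \<in> X. halts_from S Q src (l, s)"
  using h K l
proof (induction t arbitrary: l s' X rule: less_induct)
  case (less t)
  show ?case
  proof (cases "l = Suc (length body)")
    case True
    obtain s where "s \<in> X" using ne less.prems by blast
    moreover have "halts_in S Q src 0 (l, s)"
      using True by (simp add: src_def)
    ultimately show ?thesis unfolding halts_from_iff by blast
  next
    case False
    define ins where "ins = body ! (l - 1)"
    have l: "1 \<le> l" "l \<le> length body" using False less.prems by auto
    then have ins: "ins \<in> set body" by (simp add: ins_def)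
    show ?thesis
    proof (cases "straight ins")
      case True
      then obtain t' s1' where t': "t = tlen ins + t'" and s1': "s1' \<in> effs S Q' (tr ins) s'"
        and h1: "halts_in S Q' tgt t' (lab (Suc l), s1')"
        using less.prems(1) l tgt_halts_in_straight by (auto simp: ins_def)
      from st[OF ins True less.prems(2) s1'] obtain X1 where
        X1: "K s1' X1" "X1 \<subseteq> effS Q [ins] X" by blast
      have "t' < t" using t' tlen_positive[of ins] by simp
      then obtain s1 where s1: "s1 \<in> X1" "halts_from S Q src (Suc l, s1)"
        using less.IH[OF _ h1 X1(1)] l by auto
      then obtain s where "s \<in> X" "s1 \<in> eff S Q ins s"
        using X1 by (auto simp: effS_def)
      moreover obtain t1 where "halts_in S Q src t1 (Suc l, s1)"
        using s1(2) by (auto simp: halts_from_iff)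
      ultimately have "halts_in S Q src (Suc t1) (l, s)"
        using src_halts_in_straight[OF l, of "Suc t1" s] True unfolding ins_def by blast
      with \<open>s \<in> X\<close> show ?thesis unfolding halts_from_iff by blast
    next
      case False
      define l' where "l' = dest S ins s'"
      obtain t' where t': "t = Suc t'" "halts_in S Q' tgt t' (lab l', s')"
        using less.prems(1) tgt_halts_in_branch[OF l] False by (auto simp: l'_def ins_def)
      obtain s where s: "s \<in> X" "halts_from S Q src (l', s)"
        using less.IH[OF _ t'(2) less.prems(2)] t' ok[OF ins False, of s'] by (auto simp: l'_def)
      have "dest S ins s = l'"
        using br[OF ins less.prems(2) s(1)] by (simp add: l'_def)
      moreover obtain t1 where "halts_in S Q src t1 (l', s)"
        using s(2) by (auto simp: halts_from_iff)
      ultimately have "halts_in S Q src (Suc t1) (l, s)"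
        using src_halts_in_branch[OF l, of "Suc t1" s] False unfolding ins_def by blast
      with s(1) show ?thesis unfolding halts_from_iff by blast
    qed
  qed
qed

section \<open>The prologue of the target program\<close>

lemma prologue_steps:
  "halts_from S Q' tgt (1, s) \<longleftrightarrow> halts_from S Q' tgt (if fst s (k + 1) = fst s 1 then 5 else 2, s)"
  "halts_from S Q' tgt (2, s) \<longleftrightarrow>
    halts_from S Q' tgt (4, (fst s)(k + 1 := Suc (fst s (k + 1)), k + 2 := Suc (fst s (k + 2))), snd s)"
  "halts_from S Q' tgt (4, s) \<longleftrightarrow> halts_from S Q' tgt (1, s)"
  "halts_from S Q' tgt (5, s) \<longleftrightarrow> halts_from S Q' tgt (6, (fst s)(k + 2 := Suc (fst s (k + 2))), snd s)"
proof -
  have p: "4 < length (prog tgt)" "prog tgt ! 0 = IdxBr (k + 1) 1 5 2" "prog tgt ! 3 = IdxBr 1 1 1 1"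
    by (simp_all add: tgt_def tgt_prog_def)
  have p2: "prog tgt = [IdxBr (k + 1) 1 5 2] @ [IdxInc (k + 1), IdxInc (k + 2)] @ drop 3 (prog tgt)"
    and p5: "prog tgt = take 4 (prog tgt) @ [IdxInc (k + 2)] @ drop 5 (prog tgt)"
    and ne: "drop 3 (prog tgt) \<noteq> []" "drop 5 (prog tgt) \<noteq> []"
    by (simp_all add: tgt_def tgt_prog_def)
  show "halts_from S Q' tgt (1, s) \<longleftrightarrow>
      halts_from S Q' tgt (if fst s (k + 1) = fst s 1 then 5 else 2, s)"
    using halts_from_branch[of 1 tgt S Q' s] p by simp
  \<comment> \<open>\<open>IdxBr 1 1 1 1\<close> compares a register with itself, so it is an
    unconditional jump to label 1.\<close>
  show "halts_from S Q' tgt (4, s) \<longleftrightarrow> halts_from S Q' tgt (1, s)"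
    using halts_from_branch[of 4 tgt S Q' s] p by simp
  show "halts_from S Q' tgt (2, s) \<longleftrightarrow>
    halts_from S Q' tgt (4, (fst s)(k + 1 := Suc (fst s (k + 1)), k + 2 := Suc (fst s (k + 2))), snd s)"
    using halts_from_straight[OF p2 ne(1), of 2 S Q' s] by (cases s) simp
  show "halts_from S Q' tgt (5, s) \<longleftrightarrow>
      halts_from S Q' tgt (6, (fst s)(k + 2 := Suc (fst s (k + 2))), snd s)"
    using halts_from_straight[OF p5 ne(2), of 5 S Q' s] p(1) by (cases s) simp
qed

text \<open>Loop invariant: both counters hold the same \<open>d \<le> idx 1\<close>; the induction
  is on \<open>idx 1 - d\<close>. After the exit the fifth instruction moves the second counter one
  ahead, which sets up \<open>D\<close> and \<open>D + 1\<close> for \<open>D = idx 1\<close>. By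
  \<open>1 \<le> k\<close> the counters differ from \<open>I_1\<close>.\<close>

lemma prologue_loop:
  assumes "1 \<le> k" "d \<le> idx 1" "idx (k + 1) = d" "idx (k + 2) = d"
  shows "halts_from S Q' tgt (1, idx, mem) \<longleftrightarrow>
    halts_from S Q' tgt (6, idx(k + 1 := idx 1, k + 2 := Suc (idx 1)), mem)"
  using assms
proof (induction "idx 1 - d" arbitrary: d idx)
  case 0
  have "halts_from S Q' tgt (1, idx, mem) \<longleftrightarrow> halts_from S Q' tgt (5, idx, mem)"
    using 0 by (subst prologue_steps(1)) simp
  also have "\<dots> \<longleftrightarrow> halts_from S Q' tgt (6, idx(k + 2 := Suc (idx (k + 2))), mem)"
    by (subst prologue_steps) simp
  also have "idx(k + 2 := Suc (idx (k + 2))) = idx(k + 1 := idx 1, k + 2 := Suc (idx 1))"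
    using 0 by (auto simp: fun_eq_iff)
  finally show ?case .
next
  case (Suc x)
  define idx' where "idx' = idx(k + 1 := Suc d, k + 2 := Suc d)"
  have "halts_from S Q' tgt (1, idx, mem) \<longleftrightarrow> halts_from S Q' tgt (2, idx, mem)"
    using Suc.prems Suc.hyps(2) by (subst prologue_steps(1)) auto
  also have "\<dots> \<longleftrightarrow> halts_from S Q' tgt (4, idx', mem)"
    using Suc.prems by (subst prologue_steps) (simp add: idx'_def)
  also have "\<dots> \<longleftrightarrow> halts_from S Q' tgt (1, idx', mem)"
    by (rule prologue_steps)
  also have "\<dots> \<longleftrightarrow> halts_from S Q' tgt (6, idx'(k + 1 := idx' 1, k + 2 := Suc (idx' 1)), mem)"
    using Suc.prems Suc.hyps(2) by (intro Suc.hyps(1)[of _ "Suc d"]) (auto simp: idx'_def)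
  also have "idx'(k + 1 := idx' 1, k + 2 := Suc (idx' 1)) = idx(k + 1 := idx 1, k + 2 := Suc (idx 1))"
    using Suc.prems by (auto simp: idx'_def fun_eq_iff)
  finally show ?case .
qed

definition start_idx :: "nat \<Rightarrow> nat \<Rightarrow> nat" where
  "start_idx n = (\<lambda>j. if j = 1 then n else 1)(k + 1 := n, k + 2 := Suc n)"

lemma tgt_halts_from_start:
  assumes "1 \<le> k" "1 \<le> n"
  shows "halts_from S Q' tgt (1, \<lambda>j. if j = 1 then n else 1, mem) \<longleftrightarrow>
    (\<exists>s \<in> effs S Q' (concat (replicate m ext)) (start_idx n, mem). halts_from S Q' tgt (lab 1, s))"
proof -
  have "halts_from S Q' tgt (1, \<lambda>j. if j = 1 then n else 1, mem) \<longleftrightarrow>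
      halts_from S Q' tgt (6, start_idx n, mem)"
    using prologue_loop[of 1 "\<lambda>j. if j = 1 then n else 1" mem] assms
    by (simp add: start_idx_def)
  also have "list_all straight (concat (replicate m ext))"
    using straight_ext by (induction m) auto
  then have "halts_from S Q' tgt (6, start_idx n, mem) \<longleftrightarrow>
    (\<exists>s \<in> effs S Q' (concat (replicate m ext)) (start_idx n, mem).
       halts_from S Q' tgt (6 + length (concat (replicate m ext)), s))"
    by (intro halts_from_straight[where as = "take 5 tgt_prog"
          and bs = "concat (map tr body) @ [StopI]"])
      (auto simp: tgt_def tgt_prog_def)
  also have "6 + length (concat (replicate m ext)) = lab 1"
    by (simp add: lab_def off_def length_exts)
  finally show ?thesis .
qed

lemma effS_mono: "X \<subseteq> Y \<Longrightarrow> effS R xs X \<subseteq> effS R xs Y"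
  by (auto simp: effS_def)

lemma effS_append: "effS R (xs @ ys) X = effS R ys (effS R xs X)"
  by (auto simp: effS_def effs_append)

text \<open>A copy of \<open>ext\<close> corresponds to no source step, so \<open>s\<close> stays
  fixed while \<open>D\<close> grows by one per copy.\<close>

lemma forward_exts:
  assumes "\<And>D s X. R D s X \<Longrightarrow> \<exists>X1. R (Suc D) s X1 \<and> X1 \<subseteq> effS Q' ext X" "R D s X"
  shows "\<exists>X1. R (D + p) s X1 \<and> X1 \<subseteq> effS Q' (concat (replicate p ext)) X"
  using assms(2)
proof (induction p arbitrary: D X)
  case 0
  then show ?case by (auto simp: effS_def)
next
  case (Suc p)
  from assms(1)[OF Suc.prems] obtain X1 where X1: "R (Suc D) s X1" "X1 \<subseteq> effS Q' ext X" by blast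
  from Suc.IH[OF X1(1)] obtain X2 where
    X2: "R (Suc D + p) s X2" "X2 \<subseteq> effS Q' (concat (replicate p ext)) X1" by blast
  have "X2 \<subseteq> effS Q' (concat (replicate (Suc p) ext)) X"
    using X2(2) effS_mono[OF X1(2)] by (fastforce simp: effS_append)
  then show ?case using X2(1) by auto
qed

text \<open>Here the set consists of source states. Running \<open>ext\<close> leaves them unchanged
  but may rule some of them out, hence \<open>X1 \<subseteq> X\<close>.\<close>

lemma backward_exts:
  assumes "\<And>D s' s1' X. R D s' X \<Longrightarrow> s1' \<in> effs S Q' ext s' \<Longrightarrow> \<exists>X1 \<subseteq> X. R (Suc D) s1' X1"
    and "R D s' X" "s1' \<in> effs S Q' (concat (replicate p ext)) s'"
  shows "\<exists>X1 \<subseteq> X. R (D + p) s1' X1"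
  using assms(2,3)
proof (induction p arbitrary: D s' X)
  case 0
  then show ?case by auto
next
  case (Suc p)
  then obtain s0' where s0': "s0' \<in> effs S Q' ext s'" "s1' \<in> effs S Q' (concat (replicate p ext)) s0'"
    by (auto simp: effs_append)
  from assms(1)[OF Suc.prems(1) s0'(1)] obtain X1 where X1: "X1 \<subseteq> X" "R (Suc D) s0' X1" by blast
  from Suc.IH[OF X1(2) s0'(2)] obtain X2 where "X2 \<subseteq> X1" "R (Suc D + p) s1' X2" by blast
  with X1(1) show ?case by (intro exI[of _ X2]) auto
qed

section \<open>Well-formedness of the translated program\<close>

lemma wf_instr_tr:
  assumes ins: "wf_instr S b k (Suc (length body)) ins" "ins \<noteq> StopI"
    and ext: "\<And>x. x \<in> set ext \<Longrightarrow> wf_instr S b' (k + 3) (length tgt_prog) x"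
    and orc: "\<And>j x. ins = OracleI j \<Longrightarrow> x \<in> set (orc j) \<Longrightarrow> wf_instr S b' (k + 3) (length tgt_prog) x"
    and x: "x \<in> set (tr ins)"
  shows "wf_instr S b' (k + 3) (length tgt_prog) x"
proof (cases ins)
  case (IdxInc j)
  then show ?thesis using ext x ins by (auto simp: tr_def wf_instr_def[of _ _ _ _ "IdxInc j"])
next
  case (OracleI j)
  then show ?thesis using orc x by (auto simp: tr_def)
next
  case (RelBr r js l1 l2)
  then show ?thesis using x ins lab_le_length by (auto simp: tr_def wf_instr_def)
next
  case (IdxBr i j l1 l2)
  then show ?thesis using x ins lab_le_length by (auto simp: tr_def wf_instr_def)
qed (use x ins in \<open>auto simp: tr_def wf_instr_def\<close>)

lemma stop_notin_straight: "list_all straight xs \<Longrightarrow> StopI \<notin> set xs"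
  by (auto simp: list_all_iff)

lemma stop_notin_tr: "ins \<noteq> StopI \<Longrightarrow> StopI \<notin> set (tr ins)"
  using stop_notin_straight[OF straight_ext] stop_notin_straight[OF straight_orc]
  by (auto simp: tr_def split: instr.splits)

lemma wf_tgt:
  assumes k: "1 \<le> k"
    and body: "\<And>ins. ins \<in> set body \<Longrightarrow> wf_instr S b k (Suc (length body)) ins"
    and ext: "\<And>x. x \<in> set ext \<Longrightarrow> wf_instr S b' (k + 3) (length tgt_prog) x"
    and orc: "\<And>j x. OracleI j \<in> set body \<Longrightarrow> x \<in> set (orc j)
      \<Longrightarrow> wf_instr S b' (k + 3) (length tgt_prog) x"
  shows "wf_machine S b' tgt"
proof -
  have L: "5 < length tgt_prog" by (simp add: tgt_prog_def)
  have wf: "wf_instr S b' (k + 3) (length tgt_prog) x" if x: "x \<in> set tgt_prog" for x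
  proof -
    consider "x \<in> {IdxBr (k + 1) 1 5 2, IdxInc (k + 1), IdxInc (k + 2), IdxBr 1 1 1 1, StopI}"
      | "x \<in> set ext" | ins where "ins \<in> set body" "x \<in> set (tr ins)"
      using x by (auto simp: tgt_prog_def)
    then show ?thesis
    proof cases
      case 1
      then show ?thesis using L k by (auto simp: wf_instr_def)
    next
      case 2
      then show ?thesis using ext by blast
    next
      case 3
      then show ?thesis using wf_instr_tr[of b ins b' x] body ext orc no_stop by blast
    qed
  qed
  have "StopI \<notin> set (butlast tgt_prog)"
  proof -
    have "StopI \<notin> set ext" by (rule stop_notin_straight[OF straight_ext])
    moreover have "StopI \<notin> set (tr ins)" if "ins \<in> set body" for ins
      using that no_stop stop_notin_tr[of ins] by auto
    ultimately show ?thesis by (auto simp: tgt_prog_def butlast_append)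
  qed
  then have "tgt_prog ! i \<noteq> StopI" if "i < length tgt_prog - 1" for i
    using that by (metis length_butlast nth_butlast nth_mem)
  with wf show ?thesis
    by (auto simp: wf_machine_def tgt_def tgt_prog_def)
qed

end

section \<open>Coupling of the registers\<close>

text \<open>Only registers named by a fixed number count. The cells used by \<open>CopyI\<close> are
  addressed through index registers and are controlled by \<open>idx_bounded\<close>.\<close>

definition regs :: "('c, 'f, 'r) instr \<Rightarrow> nat set" where
  "regs ins = (case ins of FunI f j js \<Rightarrow> insert j (set js) | ConstI j c \<Rightarrow> {j}
     | RelBr r js l1 l2 \<Rightarrow> set js | OracleI j \<Rightarrow> {j} | _ \<Rightarrow> {})"

lemma finite_regs: "finite (regs ins)"
  by (auto simp: regs_def split: instr.splits)

text \<open>The additional index registers \<open>I\<^bsub>k+1\<^esub>\<close> and \<open>I\<^bsub>k+2\<^esub>\<close> of the target hold \<open>D\<close> and \<open>D + 1\<close>. The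
  register \<open>I\<^bsub>k+3\<^esub>\<close> addresses a fixed \<open>Z\<close>-register.\<close>

definition idx_rel :: "nat \<Rightarrow> nat \<Rightarrow> (nat \<Rightarrow> nat) \<Rightarrow> (nat \<Rightarrow> nat) \<Rightarrow> bool" where
  "idx_rel k D idx idx' = ((\<forall>j \<le> k. idx' j = idx j) \<and> idx' (k + 1) = D \<and> idx' (k + 2) = Suc D)"

definition idx_bounded :: "nat \<Rightarrow> nat \<Rightarrow> (nat \<Rightarrow> nat) \<Rightarrow> bool" where
  "idx_bounded k B idx = (\<forall>j \<le> k. idx j \<le> B)"

definition mem_agree :: "nat \<Rightarrow> (nat \<Rightarrow> 'a) \<Rightarrow> (nat \<Rightarrow> 'a) \<Rightarrow> bool" where
  "mem_agree D mem mem' = (\<forall>i \<le> D. mem' i = mem i)"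

text \<open>Describes the memory of an oracle machine beyond the cells accessed so far: all cells
  from \<open>D\<close> on still hold the same element \<open>x_n\<close>.\<close>

definition tail_const :: "nat \<Rightarrow> (nat \<Rightarrow> 'a) \<Rightarrow> bool" where
  "tail_const D mem = (\<forall>i \<ge> D. mem (Suc i) = mem i)"

lemma mem_agree_refl: "mem_agree D mem mem"
  by (simp add: mem_agree_def)

lemma mem_agree_sym: "mem_agree D mem mem' \<Longrightarrow> mem_agree D mem' mem"
  by (simp add: mem_agree_def)

lemma idx_rel_inc:
  assumes "idx_rel k D idx idx'" "j \<le> k"
  shows "idx_rel k D (idx(j := Suc (idx j))) (idx'(j := Suc (idx' j)))"
  using assms by (auto simp: idx_rel_def)

text \<open>An increment exceeds the old bound by at most one; this is why a single copy of
  \<open>ext\<close> before each \<open>IdxInc\<close> suffices.\<close>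

lemma idx_bounded_inc:
  assumes "idx_bounded k B idx"
  shows "idx_bounded k (Suc B) (idx(j := Suc (idx j)))"
  using assms by (auto simp: idx_bounded_def le_SucI)

text \<open>The instructions that the translation copies verbatim and that have exactly one
  successor state under every oracle.\<close>

definition ordinary :: "('c, 'f, 'r) instr \<Rightarrow> bool" where
  "ordinary ins = (case ins of FunI _ _ _ \<Rightarrow> True | ConstI _ _ \<Rightarrow> True | CopyI _ _ \<Rightarrow> True
     | IdxOne _ \<Rightarrow> True | _ \<Rightarrow> False)"

definition act_idx :: "('c, 'f, 'r) instr \<Rightarrow> (nat \<Rightarrow> nat) \<Rightarrow> nat \<Rightarrow> nat" where
  "act_idx ins idx = (case ins of IdxOne i \<Rightarrow> idx(i := 1) | _ \<Rightarrow> idx)"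

definition act_mem :: "('a, 'c, 'f, 'r) struct \<Rightarrow> ('c, 'f, 'r) instr \<Rightarrow> (nat \<Rightarrow> nat)
    \<Rightarrow> (nat \<Rightarrow> 'a) \<Rightarrow> nat \<Rightarrow> 'a" where
  "act_mem S ins idx mem = (case ins of FunI f j js \<Rightarrow> mem(j := fn S f (map mem js))
     | ConstI j c \<Rightarrow> mem(j := cst S c) | CopyI i i' \<Rightarrow> mem(idx i := mem (idx i')) | _ \<Rightarrow> mem)"

lemma eff_ordinary:
  "ordinary ins \<Longrightarrow> eff S Q ins (idx, mem) = {(act_idx ins idx, act_mem S ins idx mem)}"
  by (cases ins) (auto simp: ordinary_def act_idx_def act_mem_def)

lemma (in translation) tr_ordinary: "ordinary ins \<Longrightarrow> tr ins = [ins]"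
  by (cases ins) (auto simp: ordinary_def tr_def)

lemma (in translation) start_idx_rel:
  assumes "1 \<le> k"
  shows "idx_rel k n (\<lambda>j. if j = 1 then n else 1) (start_idx n)" "start_idx n (k + 3) = 1"
  using assms by (auto simp: idx_rel_def start_idx_def)

text \<open>\<open>J\<close> bounds the registers named by a fixed number. Once
  \<open>J \<le> D\<close> and the index registers are bounded by \<open>D\<close>, every cell that
  an instruction of \<open>body\<close> touches lies at or below \<open>D\<close>.\<close>

locale program =
  fixes S :: "('a, 'c, 'f, 'r) struct" and b :: bool and k J :: nat
    and body :: "('c, 'f, 'r) instr list"
  assumes k: "1 \<le> k"
    and wf: "ins \<in> set body \<Longrightarrow> wf_instr S b k (Suc (length body)) ins"
    and no_stop: "StopI \<notin> set body"
    and regs_le: "ins \<in> set body \<Longrightarrow> i \<in> regs ins \<Longrightarrow> i \<le> J"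
begin

lemma dest_in_range:
  assumes "ins \<in> set body" "\<not> straight ins"
  shows "dest S ins s \<in> {1..Suc (length body)}"
proof -
  have "ins \<noteq> StopI" using assms no_stop by blast
  then show ?thesis
    using assms wf[OF assms(1)] by (cases ins) (auto simp: wf_instr_def)
qed

lemma dest_eq:
  assumes ins: "ins \<in> set body" and "J \<le> D" "idx_rel k D idx idx'" "mem_agree D mem mem'"
  shows "dest S ins (idx', mem') = dest S ins (idx, mem)"
proof (cases ins)
  case (RelBr r js l1 l2)
  have "mem' i = mem i" if "i \<in> set js" for i
    using regs_le[OF ins, of i] that RelBr assms(2,4) by (auto simp: regs_def mem_agree_def)
  then have "map mem' js = map mem js" by simp
  then show ?thesis unfolding RelBr dest.simps snd_conv by (rule arg_cong)
next
  case (IdxBr i j l1 l2)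
  then show ?thesis
    using wf[OF ins] assms(3) by (auto simp: wf_instr_def idx_rel_def)
qed auto

lemma act_idx_rel:
  assumes "ins \<in> set body" "idx_rel k D idx idx'"
  shows "idx_rel k D (act_idx ins idx) (act_idx ins idx')"
  using wf[OF assms(1)] assms(2)
  by (cases ins) (auto simp: wf_instr_def act_idx_def idx_rel_def)

lemma act_idx_other:
  assumes "ins \<in> set body"
  shows "act_idx ins idx (k + 3) = idx (k + 3)"
  using wf[OF assms(1)] by (cases ins) (auto simp: wf_instr_def act_idx_def)

lemma act_idx_bounded:
  assumes "idx_bounded k B idx" "1 \<le> B"
  shows "idx_bounded k B (act_idx ins idx)"
  using assms by (cases ins) (auto simp: act_idx_def idx_bounded_def)

lemma act_mem_above:
  assumes ins: "ins \<in> set body" and "J \<le> B" "idx_bounded k B idx" "B < i"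
  shows "act_mem S ins idx mem i = mem i"
proof -
  have i: "i \<notin> regs ins" using regs_le[OF ins, of i] assms by auto
  show ?thesis
  proof (cases ins)
    case (CopyI j j')
    then have "idx j \<le> B"
      using wf[OF ins] assms(3) by (auto simp: wf_instr_def idx_bounded_def)
    then show ?thesis using CopyI assms(4) by (simp add: act_mem_def)
  qed (use i in \<open>auto simp: act_mem_def regs_def\<close>)
qed

lemma act_mem_agree:
  assumes ins: "ins \<in> set body" and "J \<le> D" "\<forall>j \<le> k. idx' j = idx j" "idx_bounded k D idx"
    and mem: "mem_agree D mem mem'"
  shows "mem_agree D (act_mem S ins idx mem) (act_mem S ins idx' mem')"
proof (cases ins)
  case (FunI f j js)
  have "mem' i = mem i" if "i \<in> set js" for i
    using regs_le[OF ins, of i] that FunI assms(2) mem by (auto simp: regs_def mem_agree_def)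
  then have "map mem' js = map mem js" by simp
  then have "fn S f (map mem' js) = fn S f (map mem js)" by (rule arg_cong)
  then show ?thesis using FunI mem by (simp add: act_mem_def mem_agree_def)
next
  case (CopyI j j')
  then have "idx' j = idx j" "idx' j' = idx j'" "idx j' \<le> D"
    using wf[OF ins] assms(3,4) by (auto simp: wf_instr_def idx_bounded_def)
  then show ?thesis using CopyI mem by (auto simp: act_mem_def mem_agree_def)
qed (use mem in \<open>auto simp: act_mem_def mem_agree_def\<close>)

text \<open>The instruction works only on cells up to \<open>D\<close>, so a preimage of
  \<open>m1\<close> is obtained by taking \<open>mem\<close> up to \<open>D\<close> and
  \<open>m1\<close> above. Thus cells above \<open>D\<close> can remain open across an ordinary
  step.\<close>

lemma act_mem_lift:
  assumes ins: "ins \<in> set body" and J: "J \<le> D" and eq: "\<forall>j \<le> k. idx' j = idx j"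
    and bd: "idx_bounded k D idx" and m1: "mem_agree D (act_mem S ins idx mem) m1"
  obtains mem' where "mem_agree D mem mem'" "act_mem S ins idx' mem' = m1"
proof
  define mem' where "mem' = (\<lambda>i. if i \<le> D then mem i else m1 i)"
  show agree: "mem_agree D mem mem'" by (simp add: mem_agree_def mem'_def)
  have bd': "idx_bounded k D idx'" using bd eq by (simp add: idx_bounded_def)
  show "act_mem S ins idx' mem' = m1"
  proof
    fix i
    show "act_mem S ins idx' mem' i = m1 i"
    proof (cases "i \<le> D")
      case True
      then show ?thesis
        using act_mem_agree[OF ins J eq bd agree] m1 by (simp add: mem_agree_def)
    next
      case False
      then show ?thesis
        using act_mem_above[OF ins J bd'] by (simp add: mem'_def)
    qed
  qed
qed

end

section \<open>Guessing machines as oracle machines\<close>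

definition guess_ext :: "nat \<Rightarrow> ('c, 'f, 'r) instr list" where
  "guess_ext k = [IdxInc (k + 1), IdxInc (k + 2), CopyI (k + 2) (k + 3), OracleI 1,
     CopyI (k + 1) (k + 3), CopyI (k + 3) (k + 2)]"

text \<open>The oracle can only write to a fixed register. So \<open>Z\<^sub>1\<close> is saved in the unused cell
  \<open>D + 2\<close>, receives the guess, passes it on to the cell \<open>D + 1\<close>, and is restored.\<close>

lemma effs_guess_ext:
  assumes "idx (k + 1) = D" "idx (k + 2) = Suc D" "idx (k + 3) = 1" "1 \<le> D"
  shows "effs S Uinf (guess_ext k) (idx, mem) =
    range (\<lambda>y. (idx(k + 1 := Suc D, k + 2 := Suc (Suc D)), mem(Suc (Suc D) := mem 1, Suc D := y)))"
proof -
  have "mem(Suc (Suc D) := mem 1, 1 := y, Suc D := y, 1 := mem 1) =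
      mem(Suc (Suc D) := mem 1, Suc D := y)" for y
    using assms(4) by (auto simp: fun_eq_iff)
  then show ?thesis
    using assms by (auto simp: guess_ext_def image_iff)
qed

locale nd_program = program S False k J body
  for S :: "('a, 'c, 'f, 'r) struct" and k J and body :: "('c, 'f, 'r) instr list"
begin

text \<open>The \<open>J\<close> initial copies of \<open>guess_ext\<close> bring \<open>D\<close>
  from \<open>n\<close> to \<open>n + J\<close>, so that \<open>J \<le> D\<close> holds when the
  simulation of \<open>body\<close> starts.\<close>

sublocale translation S "{}" Uinf k J body "guess_ext k" "\<lambda>j. [OracleI j]"
  by unfold_locales (auto simp: guess_ext_def no_stop)

lemma no_oracle: "OracleI j \<notin> set body"
  using wf by (fastforce simp: wf_instr_def)

lemma straight_cases:
  assumes "ins \<in> set body" "straight ins"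
  obtains "ordinary ins" | j where "ins = IdxInc j" "j \<le> k"
proof -
  have "ins \<noteq> OracleI j" for j using assms(1) no_oracle by blast
  then show ?thesis
    using that assms(2) wf[OF assms(1)] by (cases ins) (auto simp: ordinary_def wf_instr_def)
qed

lemma wf_target: "wf_machine S True tgt"
  using k wf no_oracle by (intro wf_tgt) (auto simp: guess_ext_def wf_instr_def)

text \<open>The source memory already contains all guesses, and the target can match them one at a
  time, so a single target state suffices.\<close>

definition fwd :: "nat \<Rightarrow> 'a state \<Rightarrow> 'a state set \<Rightarrow> bool" where
  "fwd D s X = (\<exists>idx' mem'. X = {(idx', mem')} \<and> idx_rel k D (fst s) idx' \<and> idx' (k + 3) = 1
     \<and> 1 \<le> D \<and> mem_agree D (snd s) mem')"

text \<open>The target has not yet guessed anything beyond cell \<open>D\<close>, so every source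
  memory that agrees with it up to \<open>D\<close> remains a candidate.\<close>

definition bwd :: "(nat \<Rightarrow> nat) \<Rightarrow> nat \<Rightarrow> 'a state \<Rightarrow> 'a state set \<Rightarrow> bool" where
  "bwd idx D s' X = (X = {idx} \<times> {mem. mem_agree D mem (snd s')} \<and> idx_rel k D idx (fst s')
     \<and> fst s' (k + 3) = 1 \<and> 1 \<le> D)"

lemma fwd_ext:
  assumes "fwd D s X"
  shows "\<exists>X1. fwd (Suc D) s X1 \<and> X1 \<subseteq> effS Uinf (guess_ext k) X"
proof -
  obtain idx mem where s: "s = (idx, mem)" by force
  obtain idx' mem' where X: "X = {(idx', mem')}" and r: "idx_rel k D idx idx'" "idx' (k + 3) = 1"
      "1 \<le> D" "mem_agree D mem mem'"
    using assms by (auto simp: fwd_def s)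
  \<comment> \<open>The oracle answer chosen is \<open>mem (Suc D)\<close>, the source's contents of
    the newly opened cell; cell \<open>D + 2\<close> keeps the saved copy of
    \<open>Z_1\<close>.\<close>
  define X1 where "X1 = {(idx'(k + 1 := Suc D, k + 2 := Suc (Suc D)),
      mem'(Suc (Suc D) := mem' 1, Suc D := mem (Suc D)))}"
  have "X1 \<subseteq> effS Uinf (guess_ext k) X"
    using r by (auto simp: effS_def X X1_def effs_guess_ext idx_rel_def)
  moreover have "fwd (Suc D) s X1"
    using r by (auto simp: fwd_def s X1_def idx_rel_def mem_agree_def le_Suc_eq)
  ultimately show ?thesis by blast
qed

lemma bwd_ext:
  assumes "bwd idx D s' X" "s1' \<in> effs S Uinf (guess_ext k) s'"
  shows "\<exists>X1 \<subseteq> X. bwd idx (Suc D) s1' X1"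
proof -
  obtain idx' mem' where s': "s' = (idx', mem')" by force
  have X: "X = {idx} \<times> {mem. mem_agree D mem mem'}" and r: "idx_rel k D idx idx'"
      "idx' (k + 3) = 1" "1 \<le> D"
    using assms(1) by (auto simp: bwd_def s')
  obtain y where s1': "s1' = (idx'(k + 1 := Suc D, k + 2 := Suc (Suc D)),
      mem'(Suc (Suc D) := mem' 1, Suc D := y))"
    using assms(2) r unfolding s' by (subst (asm) effs_guess_ext[of _ _ D]) (auto simp: idx_rel_def)
  \<comment> \<open>The answer \<open>y\<close> now fixes cell \<open>D + 1\<close> of the source,
    which narrows the candidates.\<close>
  define X1 where "X1 = {idx} \<times> {mem. mem_agree (Suc D) mem (snd s1')}"
  have "X1 \<subseteq> X" by (auto simp: X X1_def s1' mem_agree_def)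
  moreover have "bwd idx (Suc D) s1' X1"
    using r by (auto simp: bwd_def X1_def s1' idx_rel_def)
  ultimately show ?thesis by blast
qed

lemma fwd_step:
  assumes ins: "ins \<in> set body" "straight ins" and s1: "s1 \<in> eff S {} ins s"
    and D: "fwd D s X" "J \<le> D" "idx_bounded k D (fst s)"
  shows "\<exists>X1. (\<exists>D. fwd D s1 X1 \<and> J \<le> D \<and> idx_bounded k D (fst s1)) \<and> X1 \<subseteq> effS Uinf (tr ins) X"
proof -
  obtain idx mem where s: "s = (idx, mem)" by force
  from ins show ?thesis
  proof (cases rule: straight_cases)
    case 1
    obtain idx' mem' where X: "X = {(idx', mem')}" and r: "idx_rel k D idx idx'"
        "idx' (k + 3) = 1" "1 \<le> D" "mem_agree D mem mem'"
      using D by (auto simp: fwd_def s)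
    have s1: "s1 = (act_idx ins idx, act_mem S ins idx mem)"
      using s1 1 by (simp add: s eff_ordinary)
    define X1 where "X1 = {(act_idx ins idx', act_mem S ins idx' mem')}"
    have "fwd D s1 X1"
      using r act_idx_rel[OF ins(1) r(1)] act_idx_other[OF ins(1)]
        act_mem_agree[OF ins(1) D(2) _ _ r(4)] D(3)
      by (auto simp: fwd_def X1_def s1 s idx_rel_def)
    moreover have "idx_bounded k D (fst s1)"
      using act_idx_bounded D(3) r(3) by (auto simp: s1 s)
    moreover have "X1 \<subseteq> effS Uinf (tr ins) X"
      using 1 by (auto simp: X1_def X effS_def tr_ordinary eff_ordinary)
    ultimately show ?thesis using D(2) by blast
  next
    case (2 j)
    obtain X0 where X0: "fwd (Suc D) s X0" "X0 \<subseteq> effS Uinf (guess_ext k) X"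
      using fwd_ext[OF D(1)] by blast
    then obtain idx' mem' where X0': "X0 = {(idx', mem')}" and r: "idx_rel k (Suc D) idx idx'"
        "idx' (k + 3) = 1" "mem_agree (Suc D) mem mem'"
      by (auto simp: fwd_def s)
    have s1: "s1 = (idx(j := Suc (idx j)), mem)" using s1 by (simp add: s 2)
    define X1 where "X1 = {(idx'(j := Suc (idx' j)), mem')}"
    have "fwd (Suc D) s1 X1"
      using r idx_rel_inc[OF r(1) 2(2)] 2(2) by (auto simp: fwd_def X1_def s1)
    moreover have "idx_bounded k (Suc D) (fst s1)"
      using idx_bounded_inc D(3) by (auto simp: s1 s)
    moreover have "X1 \<subseteq> effS Uinf (tr ins) X"
    proof -
      have "X1 = effS Uinf [IdxInc j] X0" by (simp add: X1_def X0' effS_def)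
      then show ?thesis using effS_mono[OF X0(2)] by (simp add: 2 tr_def effS_append)
    qed
    ultimately show ?thesis using D(2) by (meson le_SucI)
  qed
qed

lemma bwd_step:
  assumes ins: "ins \<in> set body" "straight ins" and s1': "s1' \<in> effs S Uinf (tr ins) s'"
    and D: "bwd idx D s' X" "J \<le> D" "idx_bounded k D idx"
  shows "\<exists>X1. (\<exists>D idx. bwd idx D s1' X1 \<and> J \<le> D \<and> idx_bounded k D idx) \<and> X1 \<subseteq> effS {} [ins] X"
proof -
  obtain idx' mem' where s': "s' = (idx', mem')" by force
  from ins show ?thesis
  proof (cases rule: straight_cases)
    case 1
    have X: "X = {idx} \<times> {mem. mem_agree D mem mem'}" and r: "idx_rel k D idx idx'"
        "idx' (k + 3) = 1" "1 \<le> D"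
      using D by (auto simp: bwd_def s')
    have s1': "s1' = (act_idx ins idx', act_mem S ins idx' mem')"
      using s1' 1 by (simp add: s' eff_ordinary tr_ordinary)
    define X1 where "X1 = {act_idx ins idx} \<times> {mem. mem_agree D mem (snd s1')}"
    have "bwd (act_idx ins idx) D s1' X1"
      using r act_idx_rel[OF ins(1) r(1)] act_idx_other[OF ins(1)]
      by (auto simp: bwd_def X1_def s1')
    moreover have "idx_bounded k D (act_idx ins idx)"
      using act_idx_bounded D(3) r(3) by blast
    moreover have "X1 \<subseteq> effS {} [ins] X"
    proof (clarsimp simp: X1_def s1')
      fix m1 assume "mem_agree D m1 (act_mem S ins idx' mem')"
      \<comment> \<open>\<open>act_mem_lift\<close> is applied with source and target exchanged: it
        completes the source memory.\<close>
      from mem_agree_sym[OF this]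
      obtain mem where mem: "mem_agree D mem' mem" "act_mem S ins idx mem = m1"
        using act_mem_lift[OF ins(1) D(2), of idx idx' mem' m1] r(1) D(3)
        by (auto simp: idx_rel_def idx_bounded_def)
      then have "(idx, mem) \<in> X" "(act_idx ins idx, m1) \<in> eff S {} ins (idx, mem)"
        using 1 by (auto simp: X eff_ordinary mem_agree_sym)
      then show "(act_idx ins idx, m1) \<in> effS {} [ins] X" by (force simp: effS_def)
    qed
    ultimately show ?thesis using D(2) by blast
  next
    case (2 j)
    obtain s0' where s0': "s0' \<in> effs S Uinf (guess_ext k) s'" "s1' \<in> eff S Uinf (IdxInc j) s0'"
      using s1' by (auto simp: 2 tr_def effs_append)
    obtain X0 where X0: "bwd idx (Suc D) s0' X0" "X0 \<subseteq> X"
      using bwd_ext[OF D(1) s0'(1)] by blast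
    obtain idx0 mem0 where s0: "s0' = (idx0, mem0)" by force
    have X0': "X0 = {idx} \<times> {mem. mem_agree (Suc D) mem mem0}" and r: "idx_rel k (Suc D) idx idx0"
        "idx0 (k + 3) = 1"
      using X0(1) by (auto simp: bwd_def s0)
    have s1': "s1' = (idx0(j := Suc (idx0 j)), mem0)" using s0'(2) by (simp add: s0)
    define X1 where "X1 = {idx(j := Suc (idx j))} \<times> {mem. mem_agree (Suc D) mem mem0}"
    have "bwd (idx(j := Suc (idx j))) (Suc D) s1' X1"
      using r idx_rel_inc[OF r(1) 2(2)] 2(2) by (auto simp: bwd_def X1_def s1')
    moreover have "idx_bounded k (Suc D) (idx(j := Suc (idx j)))"
      using idx_bounded_inc D(3) by blast
    moreover have "X1 \<subseteq> effS {} [ins] X"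
    proof -
      have "X1 \<subseteq> effS {} [IdxInc j] X0" by (force simp: X1_def X0' effS_def)
      then show ?thesis using effS_mono[OF X0(2)] 2 by blast
    qed
    ultimately show ?thesis using D(2) by (meson le_SucI)
  qed
qed

lemma target_halts:
  assumes n: "1 \<le> n" and h: "halts_from S {} src (1, \<lambda>j. if j = 1 then n else 1, mem)"
    and agree: "mem_agree n mem mem'"
  shows "halts_from S Uinf tgt (1, \<lambda>j. if j = 1 then n else 1, mem')"
proof -
  let ?idx = "\<lambda>j::nat. if j = 1 then n else (1::nat)"
  obtain t where t: "halts_in S {} src t (1, ?idx, mem)" using h halts_from_iff by blast
  have "fwd n (?idx, mem) {(start_idx n, mem')}"
    using n agree start_idx_rel[OF k] by (simp add: fwd_def)
  from forward_exts[where R = fwd, OF fwd_ext this, of J]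
  obtain X1 where X1: "fwd (n + J) (?idx, mem) X1"
    "X1 \<subseteq> effS Uinf (concat (replicate J (guess_ext k))) {(start_idx n, mem')}" by blast
  have "\<exists>s' \<in> X1. halts_from S Uinf tgt (lab 1, s')"
  proof (rule forward_simulation[where K = "\<lambda>s X. \<exists>D. fwd D s X \<and> J \<le> D \<and> idx_bounded k D (fst s)",
        OF dest_in_range _ _ _ t])
    show "\<exists>D. fwd D (?idx, mem) X1 \<and> J \<le> D \<and> idx_bounded k D (fst (?idx, mem))"
      using X1(1) n by (intro exI[of _ "n + J"]) (auto simp: idx_bounded_def)
  qed (use fwd_step in \<open>auto simp: fwd_def intro!: dest_eq\<close>)
  then show ?thesis
    using X1(2) unfolding tgt_halts_from_start[OF k n] by (auto simp: effS_def)
qed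

text \<open>The resulting \<open>mem\<close> is arbitrary above cell \<open>n\<close>, as if
  infinitely many guesses were made; \<open>halts_from_finite_guess\<close> later cuts them down to
  a finite tuple.\<close>

lemma source_halts:
  assumes n: "1 \<le> n" and h: "halts_from S Uinf tgt (1, \<lambda>j. if j = 1 then n else 1, mem')"
  obtains mem where "mem_agree n mem mem'"
    "halts_from S {} src (1, \<lambda>j. if j = 1 then n else 1, mem)"
proof -
  let ?idx = "\<lambda>j::nat. if j = 1 then n else (1::nat)"
  define X where "X = {?idx} \<times> {mem. mem_agree n mem mem'}"
  obtain s1' t where s1': "s1' \<in> effs S Uinf (concat (replicate J (guess_ext k))) (start_idx n, mem')"
    and t: "halts_in S Uinf tgt t (lab 1, s1')"
    using h[unfolded tgt_halts_from_start[OF k n]] unfolding halts_from_iff by blast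
  have "bwd ?idx n (start_idx n, mem') X"
    using n start_idx_rel[OF k] by (simp add: bwd_def X_def)
  then have "\<exists>X1 \<subseteq> X. bwd ?idx (n + J) s1' X1"
    using s1' by (rule backward_exts[where R = "bwd ?idx", rotated]) (rule bwd_ext)
  then obtain X1 where X1: "X1 \<subseteq> X" "bwd ?idx (n + J) s1' X1" by (elim exE conjE)
  have "\<exists>s \<in> X1. halts_from S {} src (1, s)"
  proof (rule backward_simulation[where
        K = "\<lambda>s' X. \<exists>D idx. bwd idx D s' X \<and> J \<le> D \<and> idx_bounded k D idx",
        OF dest_in_range _ _ _ t])
    show "\<exists>D idx. bwd idx D s1' X1 \<and> J \<le> D \<and> idx_bounded k D idx"
      using X1(2) n by (intro exI[of _ "n + J"] exI[of _ ?idx]) (auto simp: idx_bounded_def)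
    show "X \<noteq> {}" if "\<exists>D idx. bwd idx D s' X \<and> J \<le> D \<and> idx_bounded k D idx" for s' X
      using that mem_agree_refl by (auto simp: bwd_def)
    show "dest S ins s = dest S ins s'" if "ins \<in> set body"
      "\<exists>D idx. bwd idx D s' X \<and> J \<le> D \<and> idx_bounded k D idx" "s \<in> X" for ins s' X s
      using that by (cases s') (auto simp: bwd_def intro!: dest_eq[symmetric])
  qed (use bwd_step in \<open>auto\<close>)
  then show ?thesis using X1(1) that by (auto simp: X_def)
qed

end

section \<open>Oracle machines as guessing machines\<close>

text \<open>The copy goes from cell \<open>D\<close> to cell \<open>D + 1\<close>: the lowest unread
  guess is overwritten by \<open>x_n\<close> before \<open>D\<close> moves up.\<close>

definition stream_ext :: "nat \<Rightarrow> ('c, 'f, 'r) instr list" where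
  "stream_ext k = [CopyI (k + 2) (k + 1), IdxInc (k + 1), IdxInc (k + 2)]"

text \<open>\<open>CopyI\<close> addresses cells through index registers only, so
  \<open>I_{k+3}\<close> is first counted up from 1 to \<open>j\<close>. Then \<open>Z_j\<close>
  receives the guess in cell \<open>D + 1\<close>, which is discarded afterwards.\<close>

definition stream_read :: "nat \<Rightarrow> nat \<Rightarrow> ('c, 'f, 'r) instr list" where
  "stream_read k j = (IdxOne (k + 3) # replicate (j - 1) (IdxInc (k + 3)))
     @ [CopyI (k + 3) (k + 2)] @ stream_ext k"

lemma effs_stream_ext:
  assumes "idx (k + 1) = D" "idx (k + 2) = Suc D"
  shows "effs S Q (stream_ext k) (idx, mem) =
    {(idx(k + 1 := Suc D, k + 2 := Suc (Suc D)), mem(Suc D := mem D))}"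
  using assms by (simp add: stream_ext_def)

lemma effs_replicate_IdxInc:
  "effs S Q (replicate p (IdxInc r)) (idx, mem) = {(idx(r := idx r + p), mem)}"
  by (induction p arbitrary: idx) auto

text \<open>With \<open>j < D\<close> strict, writing \<open>Z_j\<close> spares cell
  \<open>D\<close>, whose contents are copied upwards next.\<close>

lemma effs_stream_read:
  assumes "idx (k + 1) = D" "idx (k + 2) = Suc D" "1 \<le> j" "j < D"
  shows "effs S Q (stream_read k j) (idx, mem) =
    {(idx(k + 3 := j, k + 1 := Suc D, k + 2 := Suc (Suc D)),
      mem(j := mem (Suc D), Suc D := mem D))}"
proof -
  have "effs S Q (IdxOne (k + 3) # replicate (j - 1) (IdxInc (k + 3))) (idx, mem) =
      {(idx(k + 3 := j), mem)}"
    using assms(3) by (simp add: effs_replicate_IdxInc)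
  moreover have "effs S Q (stream_ext k) (idx(k + 3 := j), mem(j := mem (Suc D))) =
      {(idx(k + 3 := j, k + 1 := Suc D, k + 2 := Suc (Suc D)),
        mem(j := mem (Suc D), Suc D := mem D))}"
    using assms by (subst effs_stream_ext[of _ _ D]) auto
  ultimately show ?thesis
    unfolding stream_read_def effs_append using assms(2) by simp
qed

locale nu_program = program S True k J body
  for S :: "('a, 'c, 'f, 'r) struct" and k J and body :: "('c, 'f, 'r) instr list"
begin

text \<open>One initial copy more than \<open>J\<close>: cell \<open>D\<close> is reserved for
  \<open>x_n\<close>, so the fixed registers have to lie strictly below \<open>D\<close>.\<close>

sublocale translation S Uinf "{}" k "Suc J" body "stream_ext k" "stream_read k"
  by unfold_locales (auto simp: stream_ext_def stream_read_def no_stop list_all_iff)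

lemma straight_cases:
  assumes "ins \<in> set body" "straight ins"
  obtains "ordinary ins" | j where "ins = IdxInc j" "j \<le> k"
    | j where "ins = OracleI j" "1 \<le> j" "j \<le> J"
  using that assms(2) wf[OF assms(1)] regs_le[OF assms(1)]
  by (cases ins) (auto simp: ordinary_def wf_instr_def regs_def)

lemma wf_target: "wf_machine S False tgt"
  using k wf by (intro wf_tgt) (auto simp: stream_ext_def stream_read_def wf_instr_def)

text \<open>Target cells above \<open>D\<close> hold the answers to future oracle calls and are left
  open; the source memory is known and constant from \<open>D\<close> on.\<close>

definition fwd :: "nat \<Rightarrow> 'a state \<Rightarrow> 'a state set \<Rightarrow> bool" where
  "fwd D s X = (\<exists>idx'. X = {idx'} \<times> {mem'. mem_agree D (snd s) mem'} \<and> idx_rel k D (fst s) idx'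
     \<and> tail_const D (snd s))"

text \<open>All guesses are present in the target memory from the start, so a single source state
  suffices, with its oracle answers read off from there.\<close>

definition bwd :: "'a state \<Rightarrow> nat \<Rightarrow> 'a state \<Rightarrow> 'a state set \<Rightarrow> bool" where
  "bwd s D s' X = (X = {s} \<and> idx_rel k D (fst s) (fst s') \<and> mem_agree D (snd s) (snd s')
     \<and> tail_const D (snd s))"

lemma fwd_ext:
  assumes "fwd D s X"
  shows "\<exists>X1. fwd (Suc D) s X1 \<and> X1 \<subseteq> effS {} (stream_ext k) X"
proof -
  obtain idx mem where s: "s = (idx, mem)" by force
  obtain idx' where X: "X = {idx'} \<times> {mem'. mem_agree D mem mem'}" and r: "idx_rel k D idx idx'"
      "tail_const D mem"
    using assms by (auto simp: fwd_def s)
  define X1 where "X1 = {idx'(k + 1 := Suc D, k + 2 := Suc (Suc D))}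
      \<times> {mem'. mem_agree (Suc D) mem mem'}"
  have "X1 \<subseteq> effS {} (stream_ext k) X"
  proof
    fix s1' assume "s1' \<in> X1"
    then obtain m1 where s1': "s1' = (idx'(k + 1 := Suc D, k + 2 := Suc (Suc D)), m1)"
      and m1: "mem_agree (Suc D) mem m1" by (auto simp: X1_def)
    \<comment> \<open>\<open>m1\<close> is its own preimage: by \<open>tail_const\<close> its cells
      \<open>D\<close> and \<open>D + 1\<close> already hold the same element.\<close>
    have "m1(Suc D := m1 D) = m1"
      using m1 r(2) by (auto simp: mem_agree_def tail_const_def fun_eq_iff)
    then have "s1' \<in> effs S {} (stream_ext k) (idx', m1)"
      using r(1) by (subst effs_stream_ext[of _ _ D]) (auto simp: idx_rel_def s1')
    moreover have "(idx', m1) \<in> X" using m1 by (auto simp: X mem_agree_def)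
    ultimately show "s1' \<in> effS {} (stream_ext k) X" by (auto simp: effS_def)
  qed
  moreover have "fwd (Suc D) s X1"
    using r by (auto simp: fwd_def s X1_def idx_rel_def tail_const_def)
  ultimately show ?thesis by blast
qed

lemma bwd_ext:
  assumes "bwd s D s' X" "s1' \<in> effs S {} (stream_ext k) s'"
  shows "\<exists>X1 \<subseteq> X. bwd s (Suc D) s1' X1"
proof -
  obtain idx' mem' where s': "s' = (idx', mem')" by force
  have r: "X = {s}" "idx_rel k D (fst s) idx'" "mem_agree D (snd s) mem'" "tail_const D (snd s)"
    using assms(1) by (auto simp: bwd_def s')
  have "s1' = (idx'(k + 1 := Suc D, k + 2 := Suc (Suc D)), mem'(Suc D := mem' D))"
    using assms(2) r(2) unfolding s' by (subst (asm) effs_stream_ext[of _ _ D]) (auto simp: idx_rel_def)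
  then have "bwd s (Suc D) s1' X"
    using r by (auto simp: bwd_def idx_rel_def mem_agree_def tail_const_def le_Suc_eq)
  then show ?thesis by blast
qed

lemma tail_const_act_mem:
  assumes "ins \<in> set body" "J \<le> B" "idx_bounded k B idx" "tail_const (Suc B) mem"
  shows "tail_const (Suc B) (act_mem S ins idx mem)"
  using assms(4) act_mem_above[OF assms(1-3)] by (simp add: tail_const_def)

text \<open>\<open>B\<close> bounds the cells accessible to the source and \<open>D = B + 1\<close>,
  which keeps its accesses off the reserved cell \<open>D\<close>.\<close>

definition inv_fwd :: "'a state \<Rightarrow> 'a state set \<Rightarrow> bool" where
  "inv_fwd s X = (\<exists>B. fwd (Suc B) s X \<and> J \<le> B \<and> 1 \<le> B \<and> idx_bounded k B (fst s))"

definition inv_bwd :: "'a state \<Rightarrow> 'a state set \<Rightarrow> bool" where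
  "inv_bwd s' X = (\<exists>B s. bwd s (Suc B) s' X \<and> J \<le> B \<and> 1 \<le> B \<and> idx_bounded k B (fst s))"

lemma fwd_step:
  assumes ins: "ins \<in> set body" "straight ins" and K: "inv_fwd s X" and s1: "s1 \<in> eff S Uinf ins s"
  shows "\<exists>X1. inv_fwd s1 X1 \<and> X1 \<subseteq> effS {} (tr ins) X"
proof -
  obtain idx mem where s: "s = (idx, mem)" by force
  obtain B where D: "fwd (Suc B) s X" "J \<le> B" "1 \<le> B" "idx_bounded k B idx"
    using K by (auto simp: inv_fwd_def s)
  have bd: "idx_bounded k (Suc B) idx" using D(4) by (auto simp: idx_bounded_def le_SucI)
  obtain idx' where X: "X = {idx'} \<times> {mem'. mem_agree (Suc B) mem mem'}"
    and r: "idx_rel k (Suc B) idx idx'" "tail_const (Suc B) mem"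
    using D by (auto simp: fwd_def s)
  from ins show ?thesis
  proof (cases rule: straight_cases)
    case 1
    have s1: "s1 = (act_idx ins idx, act_mem S ins idx mem)"
      using s1 1 by (simp add: s eff_ordinary)
    define X1 where "X1 = {act_idx ins idx'} \<times> {mem'. mem_agree (Suc B) (act_mem S ins idx mem) mem'}"
    have "fwd (Suc B) s1 X1"
      using act_idx_rel[OF ins(1) r(1)] tail_const_act_mem[OF ins(1) D(2,4) r(2)]
      by (auto simp: fwd_def X1_def s1)
    then have "inv_fwd s1 X1"
      using act_idx_bounded[OF D(4,3)] D by (auto simp: inv_fwd_def s1)
    moreover have "X1 \<subseteq> effS {} (tr ins) X"
    proof (clarsimp simp: X1_def)
      fix m1 assume "mem_agree (Suc B) (act_mem S ins idx mem) m1"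
      then obtain mem' where "mem_agree (Suc B) mem mem'" "act_mem S ins idx' mem' = m1"
        using act_mem_lift[OF ins(1) le_SucI[OF D(2)], of idx' idx mem m1] r(1) bd
        by (auto simp: idx_rel_def)
      then have "(idx', mem') \<in> X" "(act_idx ins idx', m1) \<in> eff S {} ins (idx', mem')"
        using 1 by (auto simp: X eff_ordinary)
      then show "(act_idx ins idx', m1) \<in> effS {} (tr ins) X"
        using tr_ordinary[OF 1] by (force simp: effS_def)
    qed
    ultimately show ?thesis by blast
  next
    case (2 j)
    obtain X0 where X0: "fwd (Suc (Suc B)) s X0" "X0 \<subseteq> effS {} (stream_ext k) X"
      using fwd_ext[OF D(1)] by blast
    then obtain idx0 where X0': "X0 = {idx0} \<times> {mem'. mem_agree (Suc (Suc B)) mem mem'}"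
      and r0: "idx_rel k (Suc (Suc B)) idx idx0" "tail_const (Suc (Suc B)) mem"
      by (auto simp: fwd_def s)
    have s1: "s1 = (idx(j := Suc (idx j)), mem)" using s1 by (simp add: s 2)
    define X1 where "X1 = {idx0(j := Suc (idx0 j))} \<times> {mem'. mem_agree (Suc (Suc B)) mem mem'}"
    have "fwd (Suc (Suc B)) s1 X1"
      using idx_rel_inc[OF r0(1) 2(2)] r0(2) by (auto simp: fwd_def X1_def s1)
    then have "inv_fwd s1 X1"
      using idx_bounded_inc[OF D(4)] D(2,3) unfolding inv_fwd_def s1
      by (intro exI[of _ "Suc B"]) auto
    moreover have "X1 \<subseteq> effS {} (tr ins) X"
    proof -
      have "X1 \<subseteq> effS {} [IdxInc j] X0" by (force simp: X1_def X0' effS_def)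
      then show ?thesis using effS_mono[OF X0(2)] by (fastforce simp: 2 tr_def effS_append)
    qed
    ultimately show ?thesis by blast
  next
    case (3 j)
    obtain y where s1: "s1 = (idx, mem(j := y))" using s1 by (auto simp: s 3)
    define idx1 where "idx1 = idx'(k + 3 := j, k + 1 := Suc (Suc B), k + 2 := Suc (Suc (Suc B)))"
    define X1 where "X1 = {idx1} \<times> {mem'. mem_agree (Suc (Suc B)) (mem(j := y)) mem'}"
    have "fwd (Suc (Suc B)) s1 X1"
      using r 3(3) D(2) by (auto simp: fwd_def X1_def s1 idx1_def idx_rel_def tail_const_def)
    moreover have "idx_bounded k (Suc B) (fst s1)" using bd by (simp add: s1)
    ultimately have "inv_fwd s1 X1"
      using D(2,3) unfolding inv_fwd_def by (intro exI[of _ "Suc B"]) auto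
    moreover have "X1 \<subseteq> effS {} (tr ins) X"
    proof
      fix s1' assume "s1' \<in> X1"
      then obtain m1 where s1': "s1' = (idx1, m1)"
        and m1: "mem_agree (Suc (Suc B)) (mem(j := y)) m1" by (auto simp: X1_def)
      \<comment> \<open>Here an open guess is fixed: before the call, cell
        \<open>D + 1 = B + 2\<close> must hold the answer \<open>y\<close> and \<open>Z_j\<close>
        its old contents. Discarding the guess restores \<open>m1\<close> there, since by
        \<open>tail_const\<close> \<open>m1\<close> has equal entries in the cells \<open>D\<close>
        and \<open>D + 1\<close>.\<close>
      define mem' where "mem' = m1(j := mem j, Suc (Suc B) := y)"
      have j: "j < Suc B" using 3(3) D(2) by simp
      have "mem'(j := mem' (Suc (Suc B)), Suc (Suc B) := mem' (Suc B)) = m1"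
        using m1 r(2) j by (auto simp: mem_agree_def tail_const_def fun_eq_iff mem'_def)
      then have "s1' \<in> effs S {} (tr ins) (idx', mem')"
        using r(1) 3 j by (simp add: tr_def effs_stream_read[of _ _ "Suc B"] idx_rel_def s1' idx1_def)
      moreover have "(idx', mem') \<in> X" using m1 by (auto simp: X mem_agree_def mem'_def)
      ultimately show "s1' \<in> effS {} (tr ins) X" by (auto simp: effS_def)
    qed
    ultimately show ?thesis by blast
  qed
qed

lemma bwd_step:
  assumes ins: "ins \<in> set body" "straight ins" and K: "inv_bwd s' X"
    and s1': "s1' \<in> effs S {} (tr ins) s'"
  shows "\<exists>X1. inv_bwd s1' X1 \<and> X1 \<subseteq> effS Uinf [ins] X"
proof -
  obtain idx' mem' where s': "s' = (idx', mem')" by force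
  obtain B s where D: "bwd s (Suc B) s' X" "J \<le> B" "1 \<le> B" "idx_bounded k B (fst s)"
    using K by (auto simp: inv_bwd_def)
  obtain idx mem where s: "s = (idx, mem)" by force
  have bd: "idx_bounded k (Suc B) idx" using D(4) by (auto simp: idx_bounded_def le_SucI s)
  have X: "X = {(idx, mem)}" and r: "idx_rel k (Suc B) idx idx'" "mem_agree (Suc B) mem mem'"
      "tail_const (Suc B) mem"
    using D(1) by (auto simp: bwd_def s' s)
  from ins show ?thesis
  proof (cases rule: straight_cases)
    case 1
    have s1': "s1' = (act_idx ins idx', act_mem S ins idx' mem')"
      using s1' 1 by (simp add: s' eff_ordinary tr_ordinary)
    define s1 where "s1 = (act_idx ins idx, act_mem S ins idx mem)"
    have "bwd s1 (Suc B) s1' {s1}"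
      using act_idx_rel[OF ins(1) r(1)] tail_const_act_mem[OF ins(1) D(2) _ r(3)] D(4) r(1)
        act_mem_agree[OF ins(1) le_SucI[OF D(2)] _ bd r(2)]
      by (auto simp: bwd_def s1_def s1' s idx_rel_def)
    then have "inv_bwd s1' {s1}"
      using act_idx_bounded[OF D(4,3)] D(2,3) s unfolding inv_bwd_def
      by (intro exI[of _ B] exI[of _ s1]) (auto simp: s1_def)
    moreover have "{s1} \<subseteq> effS Uinf [ins] X"
      using 1 by (auto simp: X effS_def eff_ordinary s1_def)
    ultimately show ?thesis by blast
  next
    case (2 j)
    obtain s0' where s0': "s0' \<in> effs S {} (stream_ext k) s'" "s1' \<in> eff S {} (IdxInc j) s0'"
      using s1' by (auto simp: 2 tr_def effs_append)
    obtain X0 where X0: "bwd s (Suc (Suc B)) s0' X0"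
      using bwd_ext[OF D(1) s0'(1)] by blast
    obtain idx0 mem0 where s0: "s0' = (idx0, mem0)" by force
    have r0: "idx_rel k (Suc (Suc B)) idx idx0" "mem_agree (Suc (Suc B)) mem mem0"
        "tail_const (Suc (Suc B)) mem"
      using X0(1) by (auto simp: bwd_def s0 s)
    have s1': "s1' = (idx0(j := Suc (idx0 j)), mem0)" using s0'(2) by (simp add: s0)
    define s1 where "s1 = (idx(j := Suc (idx j)), mem)"
    have "bwd s1 (Suc (Suc B)) s1' {s1}"
      using r0 idx_rel_inc[OF r0(1) 2(2)] by (auto simp: bwd_def s1_def s1')
    then have "inv_bwd s1' {s1}"
      using idx_bounded_inc[OF D(4)] D(2,3) s unfolding inv_bwd_def
      by (intro exI[of _ "Suc B"] exI[of _ s1]) (auto simp: s1_def)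
    moreover have "{s1} \<subseteq> effS Uinf [ins] X"
      by (auto simp: X effS_def s1_def 2)
    ultimately show ?thesis by blast
  next
    case (3 j)
    have j: "j < Suc B" using 3(3) D(2) by simp
    have s1': "s1' = (idx'(k + 3 := j, k + 1 := Suc (Suc B), k + 2 := Suc (Suc (Suc B))),
        mem'(j := mem' (Suc (Suc B)), Suc (Suc B) := mem' (Suc B)))"
      using s1' r(1) 3 j by (simp add: tr_def effs_stream_read[of _ _ "Suc B"] idx_rel_def s')
    \<comment> \<open>The guess in cell \<open>D + 1 = B + 2\<close> serves as the oracle answer,
      which is legal because every element is one.\<close>
    define s1 where "s1 = (idx, mem(j := mem' (Suc (Suc B))))"
    have "bwd s1 (Suc (Suc B)) s1' {s1}"
      using r j by (auto simp: bwd_def s1_def s1' idx_rel_def mem_agree_def tail_const_def le_Suc_eq)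
    then have "inv_bwd s1' {s1}"
      using bd D(2,3) unfolding inv_bwd_def
      by (intro exI[of _ "Suc B"] exI[of _ s1]) (auto simp: s1_def)
    moreover have "{s1} \<subseteq> effS Uinf [ins] X"
      by (auto simp: X effS_def s1_def 3)
    ultimately show ?thesis by blast
  qed
qed

lemma target_halts:
  assumes n: "1 \<le> n" and h: "halts_from S Uinf src (1, \<lambda>j. if j = 1 then n else 1, mem)"
    and tail: "tail_const n mem"
  obtains mem' where "mem_agree n mem mem'"
    "halts_from S {} tgt (1, \<lambda>j. if j = 1 then n else 1, mem')"
proof -
  let ?idx = "\<lambda>j::nat. if j = 1 then n else (1::nat)"
  define X where "X = {start_idx n} \<times> {mem'. mem_agree n mem mem'}"
  obtain t where t: "halts_in S Uinf src t (1, ?idx, mem)" using h halts_from_iff by blast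
  have "fwd n (?idx, mem) X"
    using tail start_idx_rel[OF k, of n] unfolding fwd_def X_def
    by (intro exI[of _ "start_idx n"]) simp
  from forward_exts[where R = fwd, OF fwd_ext this, of "Suc J"]
  obtain X1 where X1: "fwd (n + Suc J) (?idx, mem) X1"
    "X1 \<subseteq> effS {} (concat (replicate (Suc J) (stream_ext k))) X" by blast
  have "\<exists>s' \<in> X1. halts_from S {} tgt (lab 1, s')"
  proof (rule forward_simulation[where K = inv_fwd, OF dest_in_range _ _ fwd_step t])
    show "inv_fwd (?idx, mem) X1"
      unfolding inv_fwd_def using X1(1) n by (intro exI[of _ "n + J"]) (auto simp: idx_bounded_def)
    show "X \<noteq> {}" if "inv_fwd s X" for s X
      using that mem_agree_refl by (auto simp: inv_fwd_def fwd_def)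
    show "dest S ins s' = dest S ins s" if "ins \<in> set body" "inv_fwd s X" "s' \<in> X" for ins s X s'
      using that by (cases s) (auto simp: inv_fwd_def fwd_def intro!: dest_eq[OF _ le_SucI])
  qed auto
  then obtain s' where s': "s' \<in> X1" "halts_from S {} tgt (lab 1, s')" by blast
  then obtain mem' where "mem_agree n mem mem'"
      "s' \<in> effs S {} (concat (replicate (Suc J) (stream_ext k))) (start_idx n, mem')"
    using X1(2) by (auto simp: effS_def X_def)
  then show ?thesis
    using that s'(2) tgt_halts_from_start[OF k n, of mem'] by blast
qed

lemma source_halts:
  assumes n: "1 \<le> n" and h: "halts_from S {} tgt (1, \<lambda>j. if j = 1 then n else 1, mem')"
    and mem: "mem_agree n mem mem'" "tail_const n mem"
  shows "halts_from S Uinf src (1, \<lambda>j. if j = 1 then n else 1, mem)"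
proof -
  let ?idx = "\<lambda>j::nat. if j = 1 then n else (1::nat)"
  obtain s1' t where
    s1': "s1' \<in> effs S {} (concat (replicate (Suc J) (stream_ext k))) (start_idx n, mem')"
    and t: "halts_in S {} tgt t (lab 1, s1')"
    using h[unfolded tgt_halts_from_start[OF k n]] unfolding halts_from_iff by blast
  have "bwd (?idx, mem) n (start_idx n, mem') {(?idx, mem)}"
    using mem start_idx_rel[OF k] by (simp add: bwd_def)
  then have "\<exists>X1 \<subseteq> {(?idx, mem)}. bwd (?idx, mem) (n + Suc J) s1' X1"
    using s1' by (rule backward_exts[where R = "bwd (?idx, mem)", rotated]) (rule bwd_ext)
  then obtain X1 where X1: "X1 \<subseteq> {(?idx, mem)}" "bwd (?idx, mem) (n + Suc J) s1' X1"
    by (elim exE conjE)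
  have "\<exists>s \<in> X1. halts_from S Uinf src (1, s)"
  proof (rule backward_simulation[where K = inv_bwd, OF dest_in_range _ _ bwd_step t])
    show "inv_bwd s1' X1"
      unfolding inv_bwd_def using X1(2) n
      by (intro exI[of _ "n + J"] exI[of _ "(?idx, mem)"]) (auto simp: idx_bounded_def)
    show "dest S ins s = dest S ins s'" if "ins \<in> set body" "inv_bwd s' X" "s \<in> X" for ins s' X s
      using that by (cases s; cases s') (auto simp: inv_bwd_def bwd_def intro!: dest_eq[OF _ le_SucI, symmetric])
  qed (auto simp: inv_bwd_def bwd_def)
  then show ?thesis using X1(1) by auto
qed

end

section \<open>The two inclusions\<close>

lemma wf_machine_program:
  fixes M :: "('c, 'f, 'r) machine"
  assumes "wf_machine S b M"
  obtains k J body where "M = \<lparr>nidx = k, prog = body @ [StopI]\<rparr>" "program S b k J body"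
proof -
  define body where "body = butlast (prog M)"
  have p: "prog M = body @ [StopI]"
    using assms by (metis append_butlast_last_id body_def wf_machine_def)
  have "StopI \<notin> set body"
  proof
    assume "StopI \<in> set body"
    then obtain i where "i < length body" "body ! i = StopI" by (auto simp: in_set_conv_nth)
    then show False using assms p by (auto simp: wf_machine_def nth_append)
  qed
  moreover have "finite (\<Union>ins \<in> set body. regs ins)" using finite_regs by blast
  then obtain J where "\<forall>i \<in> (\<Union>ins \<in> set body. regs ins). i \<le> J"
    unfolding finite_nat_set_iff_bounded_le by blast
  moreover have "\<forall>ins \<in> set body. wf_instr S b (nidx M) (Suc (length body)) ins" "1 \<le> nidx M"
    using assms p by (auto simp: wf_machine_def)
  ultimately have "program S b (nidx M) J body" by unfold_locales auto
  moreover have "M = \<lparr>nidx = nidx M, prog = body @ [StopI]\<rparr>" using p by simp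
  ultimately show ?thesis using that by blast
qed

section \<open>Initial memories and finite tuples of guesses\<close>

lemma init_mem_agree: "mem_agree (length xs) (init_mem xs ys) (init_mem xs zs)"
  by (auto simp: mem_agree_def init_mem_def nth_append)

lemma init_mem_tail: "xs \<noteq> [] \<Longrightarrow> tail_const (length xs) (init_mem xs [])"
  by (auto simp: tail_const_def init_mem_def last_conv_nth)

text \<open>A halting run depends only on the cells up to some \<open>N\<close>, so a memory that is
  arbitrary above the input can be replaced by one that arises from finitely many guesses.\<close>

lemma halts_from_finite_guess:
  assumes h: "halts_from S Q M (l, idx, mem)" "Q = {} \<or> Q = Uinf"
    and mem: "mem_agree (length xs) (init_mem xs []) mem"
  obtains ys where "ys \<noteq> []" "halts_from S Q M (l, idx, init_mem xs ys)"
proof -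
  obtain N where N: "\<And>mem'. (\<forall>i \<le> N. mem' i = mem i) \<Longrightarrow> halts_from S Q M (l, idx, mem')"
    using halts_from_finite_use[OF h] by blast
  \<comment> \<open>The \<open>N + 1\<close> cells directly above the input cover all cells up to
    \<open>N\<close>, and the tuple is nonempty even for \<open>N = 0\<close>.\<close>
  define ys where "ys = map (\<lambda>i. mem (Suc (length xs + i))) [0..<Suc N]"
  have "init_mem xs ys i = mem i" if "i \<le> N" for i
  proof (cases "i \<le> length xs")
    case True
    then have "mem i = init_mem xs [] i" using mem by (simp add: mem_agree_def)
    also have "\<dots> = init_mem xs ys i" using True by (auto simp: init_mem_def nth_append)
    finally show ?thesis by simp
  next
    case False
    have "[0..<Suc N] ! (i - 1 - length xs) = i - 1 - length xs"
      using that by (subst nth_upt) auto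
    then have "ys ! (i - 1 - length xs) = mem i"
      using that False by (simp add: ys_def del: upt_Suc)
    then show ?thesis using False that by (auto simp: init_mem_def nth_append ys_def)
  qed
  then show ?thesis using that[of ys] N by (auto simp: ys_def)
qed

lemma nd_halt_set_in_SDEC_nu:
  assumes "wf_machine S False M"
  shows "nd_halt_set S M \<in> SDEC_nu S Uinf"
proof -
  obtain k J body where M: "M = \<lparr>nidx = k, prog = body @ [StopI]\<rparr>" and "program S False k J body"
    using wf_machine_program[OF assms] .
  then interpret nd_program S k J body by (simp add: nd_program_def)
  have "nd_halt_set S src = halt_set S Uinf tgt"
  proof (intro set_eqI iffI)
    fix xs assume "xs \<in> nd_halt_set S src"
    then obtain ys where "xs \<noteq> []" "halts_from S {} src (init_config xs ys)"
      by (auto simp: nd_halt_set_def Uinf_def)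
    then show "xs \<in> halt_set S Uinf tgt"
      using target_halts[of "length xs", OF _ _ init_mem_agree]
      by (auto simp: halt_set_def Uinf_def init_config_def Suc_le_eq)
  next
    fix xs assume "xs \<in> halt_set S Uinf tgt"
    then have xs: "xs \<noteq> []" "halts_from S Uinf tgt (init_config xs [])"
      by (auto simp: halt_set_def Uinf_def)
    then obtain mem where "mem_agree (length xs) mem (init_mem xs [])"
      "halts_from S {} src (1, \<lambda>j. if j = 1 then length xs else 1, mem)"
      using source_halts[of "length xs" "init_mem xs []"]
      by (auto simp: init_config_def Suc_le_eq)
    then obtain ys where "ys \<noteq> []" "halts_from S {} src (init_config xs ys)"
      using halts_from_finite_guess mem_agree_sym unfolding init_config_def by metis
    then show "xs \<in> nd_halt_set S src" using xs by (auto simp: nd_halt_set_def Uinf_def)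
  qed
  then show ?thesis using wf_target by (auto simp: SDEC_nu_def M src_def)
qed

lemma halt_set_in_SDEC_ND:
  assumes "wf_machine S True M"
  shows "halt_set S Uinf M \<in> SDEC_ND S"
proof -
  obtain k J body where M: "M = \<lparr>nidx = k, prog = body @ [StopI]\<rparr>" and "program S True k J body"
    using wf_machine_program[OF assms] .
  then interpret nu_program S k J body by (simp add: nu_program_def)
  have "halt_set S Uinf src = nd_halt_set S tgt"
  proof (intro set_eqI iffI)
    fix xs assume "xs \<in> halt_set S Uinf src"
    then have xs: "xs \<noteq> []" "halts_from S Uinf src (init_config xs [])"
      by (auto simp: halt_set_def Uinf_def)
    then obtain mem' where "mem_agree (length xs) (init_mem xs []) mem'"
      "halts_from S {} tgt (1, \<lambda>j. if j = 1 then length xs else 1, mem')"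
      using target_halts[of "length xs" "init_mem xs []"] init_mem_tail[of xs]
      by (auto simp: init_config_def Suc_le_eq)
    then obtain ys where "ys \<noteq> []" "halts_from S {} tgt (init_config xs ys)"
      using halts_from_finite_guess unfolding init_config_def by metis
    then show "xs \<in> nd_halt_set S tgt" using xs by (auto simp: nd_halt_set_def Uinf_def)
  next
    fix xs assume "xs \<in> nd_halt_set S tgt"
    then obtain ys where xs: "xs \<noteq> []" "halts_from S {} tgt (init_config xs ys)"
      by (auto simp: nd_halt_set_def Uinf_def)
    \<comment> \<open>The guesses \<open>ys\<close> occur only in the target's memory; the source
      starts from \<open>init_mem xs []\<close>, which agrees with it on the input and is constant
      from there on.\<close>
    then show "xs \<in> halt_set S Uinf src"
      using source_halts[of "length xs", OF _ _ init_mem_agree init_mem_tail]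
      by (auto simp: halt_set_def Uinf_def init_config_def Suc_le_eq)
  qed
  then show ?thesis using wf_target by (auto simp: SDEC_ND_def M src_def)
qed

theorem mainTheorem2:
  fixes S :: "('a, 'c, 'f, 'r) struct"
  shows "SDEC_nu S Uinf = SDEC_ND S"
proof
  show "SDEC_nu S Uinf \<subseteq> SDEC_ND S"
    using halt_set_in_SDEC_ND by (auto simp: SDEC_nu_def)
  show "SDEC_ND S \<subseteq> SDEC_nu S Uinf"
    using nd_halt_set_in_SDEC_nu by (auto simp: SDEC_ND_def)
qed

end
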